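(* Let $f$ be a meromorphic function in the unit disc $\mathbb{D}$, and let $\psi_1$, $\psi_2$, $\psi_3$ be three meromorphic functions in $\mathbb{D}$, continuous on $\partial\mathbb{D}$, such that $\psi_i(z)\neq\psi_j(z)$ for all $z\in\partial\mathbb{D}$ and all $1\leq i<j\leq 3$. If $\psi_1$ and $\psi_2$ share the function $f$ on $\mathbb{D}$, that is, $$\{z\in\mathbb{D}:\psi_1(z)=f(z)\}=\{z\in\mathbb{D}:\psi_2(z)=f(z)\},$$ and $\psi_3$ avoids the function $f$ on $\mathbb{D}$, that is, $\psi_3(z)\neq f(z)$ for all $z\in\mathbb{D}$, then $f$ is a normal function.
   Context: $\mathbb{D}=\{z\in\mathbb{C}:|z|<1\}$ and $\partial\mathbb{D}=\{z\in\mathbb{C}:|z|=1\}$. Meromorphic functions are regarded as maps into the Riemann sphere $\hat{\mathbb{C}}=\mathbb{C}\cup\{\infty\}$ with the spherical metric; in particular the value $\infty$ is allowed, and equality of two functions at a point means equality in $\hat{\mathbb{C}}$ (so common poles count as points of equality). A meromorphic function $\psi$ in $\mathbb{D}$ is "continuous on $\partial\mathbb{D}$" if it is defined on $\overline{\mathbb{D}}=\mathbb{D}\cup\partial\mathbb{D}$ and is continuous at every point of $\partial\mathbb{D}$ as a map $\overline{\mathbb{D}}\to\hat{\mathbb{C}}$ (so $\psi:\overline{\mathbb{D}}\to\hat{\mathbb{C}}$ is continuous and meromorphic in $\mathbb{D}$). Sharing ignores multiplicities: it means only the equality of the sets of points displayed in the claim. A meromorphic function $f$ in $\mathbb{D}$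 is called normal if the family $\{f\circ\varphi:\varphi\in\mathrm{Aut}(\mathbb{D})\}$, where $\mathrm{Aut}(\mathbb{D})$ is the group of conformal automorphisms of $\mathbb{D}$, is a normal family in $\mathbb{D}$ with respect to the spherical metric, i.e. every sequence in the family has a subsequence converging uniformly on compact subsets of $\mathbb{D}$ in the spherical metric (to a meromorphic function or to the constant $\infty$). *)

theory Defs
  imports "HOL-Complex_Analysis.Complex_Analysis"
begin

datatype riemann_sphere = Fin complex | Infty

fun stereographic :: "riemann_sphere \<Rightarrow> complex \<times> real" where
  "stereographic (Fin z) =
     ((2 / (1 + (norm z)\<^sup>2)) *\<^sub>R z, ((norm z)\<^sup>2 - 1) / (1 + (norm z)\<^sup>2))"
| "stereographic Infty = (0, 1)"

lemma inner_stereographic_self: "stereographic p \<bullet> stereographic p = 1"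
proof (cases p)
  case (Fin z)
  define n where "n = (norm z)\<^sup>2"
  have n: "1 + n > 0"
    by (simp add: n_def add_pos_nonneg)
  have "z \<bullet> z = n"
    by (simp add: n_def power2_norm_eq_inner)
  hence "stereographic p \<bullet> stereographic p = (2 / (1 + n))\<^sup>2 * n + ((n - 1) / (1 + n))\<^sup>2"
    by (simp add: Fin flip: n_def) (simp add: power2_eq_square)
  also have "\<dots> = (4 * n + (n - 1)\<^sup>2) / (1 + n)\<^sup>2"
    by (simp add: power_divide add_divide_distrib)
  also have "4 * n + (n - 1)\<^sup>2 = (1 + n)\<^sup>2"
    by (simp add: power2_eq_square algebra_simps)
  also have "(1 + n)\<^sup>2 / (1 + n)\<^sup>2 = 1"
    using n by simp
  finally show ?thesis .
qed simp

lemma norm_stereographic: "norm (stereographic p) = 1"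
  by (simp add: norm_eq_sqrt_inner inner_stereographic_self)

lemma stereographic_inject: "stereographic p = stereographic q \<longleftrightarrow> p = q"
proof
  have aux: "z = w" if "stereographic (Fin z) = stereographic (Fin w)" for z w
  proof -
    define m n where "m = (norm z)\<^sup>2" and "n = (norm w)\<^sup>2"
    have pos: "1 + m > 0" "1 + n > 0"
      by (simp_all add: m_def n_def add_pos_nonneg)
    have "(m - 1) / (1 + m) = (n - 1) / (1 + n)"
      using that by (simp add: m_def n_def)
    hence "m = n"
      using pos by (simp add: field_simps)
    thus ?thesis
      using that pos by (simp flip: m_def n_def)
  qed
  have aux': "stereographic (Fin z) \<noteq> (0, 1)" for z
  proof
    assume "stereographic (Fin z) = (0, 1)"
    hence *: "((norm z)\<^sup>2 - 1) / (1 + (norm z)\<^sup>2) = 1"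
      by simp
    have "1 + (norm z)\<^sup>2 > 0"
      by (simp add: add_pos_nonneg)
    with * show False
      by (simp add: field_simps)
  qed
  assume "stereographic p = stereographic q"
  thus "p = q"
    using aux aux' by (metis riemann_sphere.exhaust stereographic.simps(2))
qed simp

lemma abs_inner_stereographic: "\<bar>stereographic p \<bullet> stereographic q\<bar> \<le> 1"
  using Cauchy_Schwarz_ineq2[of "stereographic p" "stereographic q"]
  by (simp add: norm_stereographic)

lemma arccos_inner_triangle:
  fixes x y z :: "'a :: real_inner"
  assumes "norm x = 1" "norm y = 1" "norm z = 1"
  shows "arccos (x \<bullet> y) \<le> arccos (x \<bullet> z) + arccos (y \<bullet> z)"
proof -
  define a b where "a = x \<bullet> z" and "b = y \<bullet> z"
  have ab: "\<bar>a\<bar> \<le> 1" "\<bar>b\<bar> \<le> 1" "\<bar>x \<bullet> y\<bar> \<le> 1"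
    using Cauchy_Schwarz_ineq2[of x z] Cauchy_Schwarz_ineq2[of y z] Cauchy_Schwarz_ineq2[of x y] assms
    by (simp_all add: a_def b_def)
  have self: "x \<bullet> x = 1" "y \<bullet> y = 1" "z \<bullet> z = 1"
    using assms by (simp_all add: norm_eq_1)
  define u v where "u = x - a *\<^sub>R z" and "v = y - b *\<^sub>R z"
  have "u \<bullet> u = 1 - a\<^sup>2" "v \<bullet> v = 1 - b\<^sup>2"
    using self by (simp_all add: u_def v_def inner_diff_left inner_diff_right power2_eq_square
        inner_commute[of z x] inner_commute[of z y] inner_commute[of y x] flip: a_def b_def)
  hence uv: "norm u = sqrt (1 - a\<^sup>2)" "norm v = sqrt (1 - b\<^sup>2)"
    by (simp_all add: norm_eq_sqrt_inner)
  have "x \<bullet> y = a * b + u \<bullet> v"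
    using self by (simp add: u_def v_def inner_diff_left inner_diff_right
        inner_commute[of z x] inner_commute[of z y] inner_commute[of y x] flip: a_def b_def)
  moreover have "- (norm u * norm v) \<le> u \<bullet> v"
    using Cauchy_Schwarz_ineq2[of u v] by linarith
  ultimately have "cos (arccos a + arccos b) \<le> x \<bullet> y"
    using ab by (simp add: cos_add sin_arccos_abs uv)
  hence *: "arccos (x \<bullet> y) \<le> arccos (cos (arccos a + arccos b))"
    using ab by (intro arccos_le_arccos) auto
  show ?thesis
  proof (cases "arccos a + arccos b \<le> pi")
    case True
    moreover have "0 \<le> arccos a + arccos b"
      using ab arccos_lbound[of a] arccos_lbound[of b] by (simp add: abs_le_iff)
    ultimately show ?thesis
      using * by (simp add: arccos_cos flip: a_def b_def)
  next
    case False
    thus ?thesis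
      using arccos_ubound[of "x \<bullet> y"] ab by (simp add: abs_le_iff flip: a_def b_def)
  qed
qed

text \<open>
  The spherical metric is the geodesic (great-circle) distance on the unit sphere,
  pulled back along stereographic projection; its line element is \<open>2 |dz| / (1 + |z|\<^sup>2)\<close>.
\<close>
instantiation riemann_sphere :: metric_space
begin

definition dist_riemann_sphere :: "riemann_sphere \<Rightarrow> riemann_sphere \<Rightarrow> real" where
  "dist p q = arccos (stereographic p \<bullet> stereographic q)"

definition uniformity_riemann_sphere :: "(riemann_sphere \<times> riemann_sphere) filter" where
  "uniformity_riemann_sphere = (INF e\<in>{0<..}. principal {(p, q). dist p q < e})"

definition open_riemann_sphere :: "riemann_sphere set \<Rightarrow> bool" where
  "open_riemann_sphere U \<longleftrightarrow> (\<forall>p\<in>U. eventually (\<lambda>(p', q). p' = p \<longrightarrow> q \<in> U) uniformity)"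

instance
proof
  fix p q r :: riemann_sphere
  show "dist p q = 0 \<longleftrightarrow> p = q"
  proof
    assume "dist p q = 0"
    hence "cos (arccos (stereographic p \<bullet> stereographic q)) = 1"
      by (simp add: dist_riemann_sphere_def)
    hence "stereographic p \<bullet> stereographic q = 1"
      using abs_inner_stereographic[of p q] by (simp add: cos_arccos_abs)
    hence "(stereographic p - stereographic q) \<bullet> (stereographic p - stereographic q) = 0"
      by (simp add: inner_diff_left inner_diff_right inner_stereographic_self inner_commute)
    thus "p = q"
      by (simp add: stereographic_inject)
  qed (simp add: dist_riemann_sphere_def inner_stereographic_self)
  show "dist p q \<le> dist p r + dist q r"
    unfolding dist_riemann_sphere_def by (intro arccos_inner_triangle norm_stereographic)
qed (simp_all add: uniformity_riemann_sphere_def open_riemann_sphere_def)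

end

text \<open>
  The library represents a meromorphic function by a complex-valued one whose value at a pole is
  the dummy value 0; here that value is replaced by \<^const>\<open>Infty\<close>. The constant function
  \<^const>\<open>Infty\<close> is not meromorphic in this sense (on a nonempty set).
\<close>
definition sphere_meromorphic_on :: "(complex \<Rightarrow> riemann_sphere) \<Rightarrow> complex set \<Rightarrow> bool" where
  "sphere_meromorphic_on f A \<longleftrightarrow>
     (\<exists>g. g nicely_meromorphic_on A \<and>
          (\<forall>z\<in>A. f z = (if is_pole g z then Infty else Fin (g z))))"

definition normal_family_on :: "(complex \<Rightarrow> riemann_sphere) set \<Rightarrow> complex set \<Rightarrow> bool" where
  "normal_family_on \<F> A \<longleftrightarrow>
     (\<forall>F :: nat \<Rightarrow> complex \<Rightarrow> riemann_sphere. range F \<subseteq> \<F> \<longrightarrow>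
        (\<exists>r g. strict_mono r \<and>
               (\<forall>K. compact K \<and> K \<subseteq> A \<longrightarrow> uniform_limit K (F \<circ> r) g sequentially) \<and>
               (sphere_meromorphic_on g A \<or> (\<forall>z\<in>A. g z = Infty))))"

text \<open>
  Maps are total, so two elements of \<open>disc_automorphisms\<close> may differ outside the disc without
  being different as automorphisms.
\<close>
definition disc_automorphisms :: "(complex \<Rightarrow> complex) set" where
  "disc_automorphisms =
     {\<phi>. \<phi> holomorphic_on ball 0 1 \<and> bij_betw \<phi> (ball 0 1) (ball 0 1)}"

definition normal_function :: "(complex \<Rightarrow> riemann_sphere) \<Rightarrow> bool" where
  "normal_function f \<longleftrightarrow> 
     sphere_meromorphic_on f (ball 0 1) \<and>
     normal_family_on {f \<circ> \<phi> | \<phi>. \<phi> \<in> disc_automorphisms} (ball 0 1)"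

end

theory Submission
  imports Defs
begin

text \<open>
  A sequence of holomorphic self-maps \<open>\<phi>\<^sub>n\<close> of the disc has a locally uniformly convergent
  subsequence whose limit \<open>\<phi>\<close> is either a self-map of the disc, in which case
  \<open>f \<circ> \<phi>\<^sub>n \<rightarrow> f \<circ> \<phi>\<close>, or a constant \<open>b\<close> on the unit circle. In the latter case the
  \<open>\<psi>\<^sub>i\<close> are pairwise distinct near \<open>b\<close>, so there the shared values disappear and \<open>f\<close>
  omits all three of the \<open>\<psi>\<^sub>i\<close>. Hence the cross ratio \<open>h\<close> of \<open>f, \<psi>\<^sub>1, \<psi>\<^sub>2, \<psi>\<^sub>3\<close> is
  holomorphic near \<open>b\<close> and omits 0 and 1, so \<open>h \<circ> \<phi>\<^sub>n\<close> is normal by Montel's theorem. Since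
  the \<open>\<psi>\<^sub>i\<close> tend to distinct values at \<open>b\<close>, the Moebius transformations that recover \<open>f\<close> from
  \<open>h\<close> converge to an invertible one, and \<open>f \<circ> \<phi>\<^sub>n\<close> is normal as well. Meromorphic functions
  are represented by homogeneous coordinates so that poles need no separate treatment.
\<close>

section \<open>Homogeneous coordinates on the Riemann sphere\<close>

text \<open>The zero vector represents no point and falls to \<open>Infty\<close> by default, so
  statements about represented points assume nonzero vectors.\<close>

definition proj_point :: "complex \<times> complex \<Rightarrow> riemann_sphere" where
  "proj_point v = (if snd v = 0 then Infty else Fin (fst v / snd v))"

fun hom_coords :: "riemann_sphere \<Rightarrow> complex \<times> complex" where
  "hom_coords (Fin w) = (w, 1)"
| "hom_coords Infty = (1, 0)"

text \<open>The 2 by 2 determinant with columns \<open>v\<close> and \<open>w\<close>: bilinear,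
  alternating, and zero exactly on linearly dependent pairs.\<close>

definition wedge :: "complex \<times> complex \<Rightarrow> complex \<times> complex \<Rightarrow> complex" where
  "wedge v w = fst v * snd w - snd v * fst w"

lemma hom_coords_nonzero: "hom_coords p \<noteq> 0"
  by (cases p) (auto simp: zero_prod_def)

lemma proj_point_hom_coords: "proj_point (hom_coords p) = p"
  by (cases p) (auto simp: proj_point_def)

lemma proj_point_eq_iff:
  assumes "v \<noteq> 0" "w \<noteq> 0"
  shows "proj_point v = proj_point w \<longleftrightarrow> wedge v w = 0"
proof -
  obtain a b c d where vw: "v = (a, b)" "w = (c, d)" by fastforce
  have "a / b = c / d \<longleftrightarrow> a * d - b * c = 0" if "b \<noteq> 0" "d \<noteq> 0"
    using that by (simp add: frac_eq_eq mult.commute)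
  then show ?thesis
    using assms by (auto simp: vw proj_point_def wedge_def zero_prod_def)
qed

section \<open>The spherical metric in homogeneous coordinates\<close>

text \<open>Clearing the squared norm of \<open>b\<close> from the stereographic formula for
  \<open>a / b\<close> gives an expression that remains right at \<open>b = 0\<close>, so one
  formula covers the whole sphere.\<close>

lemma stereographic_proj_point:
  assumes "(a, b) \<noteq> 0"
  shows "stereographic (proj_point (a, b)) =
    ((2 / ((norm a)\<^sup>2 + (norm b)\<^sup>2)) *\<^sub>R (a * cnj b),
     ((norm a)\<^sup>2 - (norm b)\<^sup>2) / ((norm a)\<^sup>2 + (norm b)\<^sup>2))"
proof (cases "b = 0")
  case True
  then show ?thesis using assms by (simp add: proj_point_def zero_prod_def)
next
  case False
  define m n where "m = (norm a)\<^sup>2" and "n = (norm b)\<^sup>2"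
  have n: "n > 0" "m \<ge> 0" using False by (auto simp: m_def n_def)
  have s: "(norm (a / b))\<^sup>2 = m / n"
    by (simp add: norm_divide power_divide m_def n_def)
  have "1 + m / n = (m + n) / n" using n by (simp add: field_simps)
  then have 1: "2 / (1 + m / n) = 2 * n / (m + n)" by simp
  have 2: "(m / n - 1) / (1 + m / n) = (m - n) / (m + n)"
    using n by (simp add: divide_simps add_pos_nonneg)
  have "of_real n = b * cnj b" by (simp only: n_def complex_norm_square)
  then have 3: "n *\<^sub>R (a / b) = a * cnj b"
    using False by (simp add: scaleR_conv_of_real)
  have "(2 * n / (m + n)) *\<^sub>R (a / b) = (2 / (m + n)) *\<^sub>R (n *\<^sub>R (a / b))" by simp
  then show ?thesis using False 1 2 3
    by (simp only: proj_point_def fst_conv snd_conv if_False stereographic.simps s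
        flip: m_def n_def)
qed

text \<open>If \<open>t\<close> is the inner product of two unit vectors, their geodesic distance is
  \<open>arccos t\<close> and their chordal distance is \<open>sqrt (2 - 2 * t)\<close>. Smallness
  of either means that \<open>t\<close> is close to 1.\<close>

lemma tendsto_riemann_sphere_iff:
  "(F \<longlongrightarrow> p) X \<longleftrightarrow> ((\<lambda>x. stereographic (F x)) \<longlongrightarrow> stereographic p) X"
proof
  assume "(F \<longlongrightarrow> p) X"
  then have "((\<lambda>x. dist (F x) p) \<longlongrightarrow> 0) X" by (rule tendsto_dist_iff[THEN iffD1])
  then have "((\<lambda>x. cos (dist (F x) p)) \<longlongrightarrow> cos 0) X" by (rule isCont_tendsto_compose[OF isCont_cos])
  moreover have "cos (dist q p) = stereographic q \<bullet> stereographic p" for q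
    using abs_inner_stereographic[of q p] by (simp add: dist_riemann_sphere_def cos_arccos_abs)
  ultimately have "((\<lambda>x. sqrt (2 - 2 * (stereographic (F x) \<bullet> stereographic p))) \<longlongrightarrow> sqrt (2 - 2 * 1)) X"
    by (intro tendsto_intros) simp
  moreover have "sqrt (2 - 2 * (stereographic q \<bullet> stereographic p)) = dist (stereographic q) (stereographic p)" for q
    by (simp add: dist_norm norm_eq_sqrt_inner inner_diff_left inner_diff_right
        inner_stereographic_self inner_commute)
  ultimately show "((\<lambda>x. stereographic (F x)) \<longlongrightarrow> stereographic p) X"
    by (subst tendsto_dist_iff) simp
next
  assume "((\<lambda>x. stereographic (F x)) \<longlongrightarrow> stereographic p) X"
  then have "((\<lambda>x. stereographic (F x) \<bullet> stereographic p) \<longlongrightarrow> stereographic p \<bullet> stereographic p) X"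
    by (intro tendsto_intros)
  then have "((\<lambda>x. arccos (stereographic (F x) \<bullet> stereographic p)) \<longlongrightarrow> arccos (stereographic p \<bullet> stereographic p)) X"
    using abs_inner_stereographic
    by (intro continuous_on_tendsto_compose[OF continuous_on_arccos'])
       (auto simp: inner_stereographic_self abs_le_iff minus_le_iff)
  then show "(F \<longlongrightarrow> p) X"
    by (subst tendsto_dist_iff) (simp add: dist_riemann_sphere_def inner_stereographic_self)
qed

lemma continuous_on_proj_point: "continuous_on (- {0}) proj_point"
proof -
  let ?N = "\<lambda>v :: complex \<times> complex. (norm (fst v))\<^sup>2 + (norm (snd v))\<^sup>2"
  let ?s = "\<lambda>v :: complex \<times> complex.
    ((2 / ?N v) *\<^sub>R (fst v * cnj (snd v)), ((norm (fst v))\<^sup>2 - (norm (snd v))\<^sup>2) / ?N v)"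
  have s: "stereographic (proj_point v) = ?s v" if "v \<noteq> 0" for v
    using stereographic_proj_point[of "fst v" "snd v"] that by simp
  have N: "?N v \<noteq> 0" if "v \<noteq> 0" for v
    using that by (cases v) (auto simp: zero_prod_def sum_power2_eq_zero_iff)
  have "continuous_on (- {0}) ?s"
    using N by (intro continuous_intros) auto
  then have "continuous_on (- {0}) (\<lambda>v. stereographic (proj_point v))"
    using s by (subst continuous_on_cong[OF refl, of _ _ ?s]) auto
  then show ?thesis by (auto simp: continuous_on_def tendsto_riemann_sphere_iff)
qed

text \<open>
  The projection \<^const>\<open>proj_point\<close> has no global continuous section, so the section depends on
  the point at which continuity is wanted.
\<close>
lemma continuous_section:
  obtains \<sigma> where "isCont \<sigma> p" "\<And>q. \<sigma> q \<noteq> 0" "\<And>q. proj_point (\<sigma> q) = q"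
proof -
  let ?x = "\<lambda>q. fst (stereographic q)" and ?t = "\<lambda>q. snd (stereographic q)"
  have st: "(stereographic \<longlongrightarrow> stereographic p) (at p)"
    using tendsto_riemann_sphere_iff[of "\<lambda>q. q" p "at p"] by simp
  have norm0: "1 + (norm z)\<^sup>2 > 0" for z :: complex by (simp add: add_pos_nonneg)
  show ?thesis
  proof (cases p)
    case (Fin w)
    \<comment> \<open>Inverse stereographic projection \<open>x / (1 - t)\<close> recovers
      \<open>z\<close>; it breaks down only at \<open>Infty\<close>, which is away from
      \<open>p\<close>.\<close>
    have eq: "((1 / (1 - ?t q)) *\<^sub>R ?x q, 1) = hom_coords q" if ne: "q \<noteq> Infty" for q
    proof -
      obtain z where z: "q = Fin z" using ne by (cases q) auto
      define c where "c = 2 / (1 + (norm z)\<^sup>2)"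
      have "c \<noteq> 0" using norm0[of z] by (simp add: c_def)
      moreover have "1 - ?t q = c" using norm0[of z] by (simp add: z c_def field_simps)
      moreover have "?x q = c *\<^sub>R z" by (simp add: z c_def)
      ultimately have "(1 / (1 - ?t q)) *\<^sub>R ?x q = z" by (simp del: stereographic.simps)
      then show ?thesis by (simp add: z del: stereographic.simps)
    qed
    have "1 - ?t p \<noteq> 0" using norm0[of w] by (auto simp: Fin field_simps)
    then have "((\<lambda>q. ((1 / (1 - ?t q)) *\<^sub>R ?x q, 1 :: complex)) \<longlongrightarrow> ((1 / (1 - ?t p)) *\<^sub>R ?x p, 1)) (at p)"
      by (intro tendsto_intros st)
    moreover have "((1 / (1 - ?t p)) *\<^sub>R ?x p, 1) = hom_coords p"
      using eq Fin by blast
    moreover have "\<forall>\<^sub>F q in at p. q \<noteq> Infty"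
      using Fin by (intro eventually_neq_at_within)
    then have "\<forall>\<^sub>F q in at p. ((1 / (1 - ?t q)) *\<^sub>R ?x q, 1) = hom_coords q"
      by eventually_elim (rule eq)
    ultimately have "(hom_coords \<longlongrightarrow> hom_coords p) (at p)"
      by (auto intro: Lim_transform_eventually)
    then show ?thesis
      using that[of hom_coords] hom_coords_nonzero proj_point_hom_coords by (simp add: isCont_def)
  next
    case Infty
    \<comment> \<open>\<open>cnj x / (1 + t)\<close> equals \<open>1 / z\<close>, the coordinate at
      infinity. It fails at \<open>Fin 0\<close>, where \<open>t = -1\<close>, so a separate value
      is put there; continuity at \<open>Infty\<close> is unaffected.\<close>
    define \<sigma> :: "riemann_sphere \<Rightarrow> complex \<times> complex" where "\<sigma> q = (if q = Fin 0 then (0, 1) else (1, (1 / (1 + ?t q)) *\<^sub>R cnj (?x q)))" for q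
    have eq: "(1 / (1 + ?t (Fin z))) *\<^sub>R cnj (?x (Fin z)) = inverse z" if "z \<noteq> 0" for z
    proof -
      define c where "c = 2 / (1 + (norm z)\<^sup>2)"
      have c: "c \<noteq> 0" using norm0[of z] by (simp add: c_def)
      have t: "1 + ?t (Fin z) = c * (norm z)\<^sup>2" using norm0[of z] by (simp add: c_def field_simps)
      have x: "cnj (?x (Fin z)) = c *\<^sub>R cnj z" by (simp add: c_def scaleR_conv_of_real)
      have "(1 / (1 + ?t (Fin z))) *\<^sub>R cnj (?x (Fin z)) = (1 / (norm z)\<^sup>2) *\<^sub>R cnj z"
        unfolding t x using c by simp
      also have "\<dots> = cnj z / of_real ((norm z)\<^sup>2)"
        by (simp add: scaleR_conv_of_real)
      also have "\<dots> = inverse z"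
        unfolding complex_norm_square using that by (simp add: field_simps)
      finally show ?thesis .
    qed
    have "((\<lambda>q. (1 :: complex, (1 / (1 + ?t q)) *\<^sub>R cnj (?x q))) \<longlongrightarrow> (1, (1 / (1 + ?t p)) *\<^sub>R cnj (?x p))) (at p)"
      using Infty by (intro tendsto_intros st) auto
    moreover have "(1, (1 / (1 + ?t p)) *\<^sub>R cnj (?x p)) = \<sigma> p"
      using Infty by (simp add: \<sigma>_def)
    moreover have "\<forall>\<^sub>F q in at p. q \<noteq> Fin 0"
      using Infty by (intro eventually_neq_at_within)
    then have "\<forall>\<^sub>F q in at p. (1, (1 / (1 + ?t q)) *\<^sub>R cnj (?x q)) = \<sigma> q"
      by eventually_elim (simp add: \<sigma>_def)
    ultimately have "(\<sigma> \<longlongrightarrow> \<sigma> p) (at p)"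
      by (auto intro: Lim_transform_eventually)
    moreover have "\<sigma> q \<noteq> 0" for q by (auto simp: \<sigma>_def zero_prod_def)
    moreover have "proj_point (\<sigma> q) = q" for q
    proof (cases q)
      case (Fin z)
      then show ?thesis using eq[of z] by (cases "z = 0") (auto simp: \<sigma>_def proj_point_def divide_inverse simp del: stereographic.simps(1))
    qed (simp add: \<sigma>_def proj_point_def)
    ultimately show ?thesis using that[of \<sigma>] by (simp add: isCont_def)
  qed
qed

text \<open>\<open>G\<close> is uniformly continuous on a compact neighbourhood of the image of
  \<open>K\<close> under \<open>l\<close>, and \<open>u n\<close> eventually maps \<open>K\<close>
  into that neighbourhood.\<close>

lemma uniform_limit_compose_continuous_on:
  fixes u :: "'i \<Rightarrow> 'a \<Rightarrow> 'b :: heine_borel" and G :: "'b \<Rightarrow> 'c :: metric_space"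
  assumes lim: "uniform_limit K u l F" and l: "compact (l ` K)" "l ` K \<subseteq> S"
    and S: "open S" "continuous_on S G"
  shows "uniform_limit K (\<lambda>n x. G (u n x)) (\<lambda>x. G (l x)) F"
proof -
  obtain e where e: "e > 0" "(\<Union>x\<in>l ` K. cball x e) \<subseteq> S"
    using compact_subset_open_imp_cball_epsilon_subset[OF l(1) S(1) l(2)] by blast
  let ?B = "\<Union>x\<in>l ` K. cball x e"
  have B: "compact ?B" by (rule compact_minkowski_sum_cball[OF l(1)])
  have "uniformly_continuous_on ?B G"
    by (rule compact_uniformly_continuous[OF continuous_on_subset[OF S(2) e(2)] B])
  moreover have "\<forall>\<^sub>F n in F. \<forall>y\<in>K. u n y \<in> ?B"
    using uniform_limitD[OF lim e(1)] by eventually_elim (force simp: dist_commute)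
  ultimately show ?thesis
    by (rule uniform_limit_compose_uniformly_continuous_on[OF lim _ _ compact_imp_closed[OF B]])
qed

section \<open>Holomorphic maps into the Riemann sphere\<close>

text \<open>
  Unlike \<^const>\<open>sphere_meromorphic_on\<close>, this includes the constant map to \<^const>\<open>Infty\<close>.
\<close>
definition sphere_holomorphic_on :: "(complex \<Rightarrow> riemann_sphere) \<Rightarrow> complex set \<Rightarrow> bool" where
  "sphere_holomorphic_on F A \<longleftrightarrow>
     (\<forall>z\<in>A. \<exists>a b. a analytic_on {z} \<and> b analytic_on {z} \<and> (a z, b z) \<noteq> 0 \<and>
        (\<forall>\<^sub>F w in nhds z. F w = proj_point (a w, b w)))"

text \<open>The definition asks for a nonzero pair only at \<open>z\<close>; continuity extends this
  to a neighbourhood.\<close>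

lemma sphere_holomorphic_onE:
  assumes "sphere_holomorphic_on F A" "z \<in> A"
  obtains a b where "a analytic_on {z}" "b analytic_on {z}" "(a z, b z) \<noteq> 0"
    "\<forall>\<^sub>F w in nhds z. F w = proj_point (a w, b w)" "\<forall>\<^sub>F w in nhds z. (a w, b w) \<noteq> 0"
proof -
  obtain a b where ab: "a analytic_on {z}" "b analytic_on {z}" "(a z, b z) \<noteq> 0"
    "\<forall>\<^sub>F w in nhds z. F w = proj_point (a w, b w)"
    using assms unfolding sphere_holomorphic_on_def by blast
  have "isCont a z" "isCont b z"
    using ab by (simp_all add: analytic_at_imp_isCont)
  then have "isCont (\<lambda>w. (a w, b w)) z" by (intro continuous_intros)
  then have "\<forall>\<^sub>F w in at z. (a w, b w) \<noteq> 0"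
    using ab(3) unfolding isCont_def by (rule tendsto_imp_eventually_ne)
  then have "\<forall>\<^sub>F w in nhds z. (a w, b w) \<noteq> 0"
    using ab(3) by (simp add: eventually_nhds_conv_at)
  with ab show ?thesis by (rule that)
qed

lemma sphere_holomorphic_on_proj_point:
  assumes "a holomorphic_on A" "b holomorphic_on A" "open A" "\<And>z. z \<in> A \<Longrightarrow> (a z, b z) \<noteq> 0"
  shows "sphere_holomorphic_on (\<lambda>z. proj_point (a z, b z)) A"
  unfolding sphere_holomorphic_on_def
proof
  fix z assume z: "z \<in> A"
  have "a analytic_on A" "b analytic_on A"
    using assms by (simp_all add: analytic_on_open)
  then have "a analytic_on {z}" "b analytic_on {z}"
    using z analytic_on_subset by blast+
  then show "\<exists>a' b'. a' analytic_on {z} \<and> b' analytic_on {z} \<and> (a' z, b' z) \<noteq> 0 \<and>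
      (\<forall>\<^sub>F w in nhds z. proj_point (a w, b w) = proj_point (a' w, b' w))"
    using assms(4)[OF z] by (intro exI[of _ a] exI[of _ b]) auto
qed

lemma sphere_holomorphic_on_imp_continuous_on:
  assumes "sphere_holomorphic_on F A"
  shows "continuous_on A F"
proof -
  have "isCont F z" if z: "z \<in> A" for z
  proof -
    obtain a b where ab: "a analytic_on {z}" "b analytic_on {z}" "(a z, b z) \<noteq> 0"
      "\<forall>\<^sub>F w in nhds z. F w = proj_point (a w, b w)" "\<forall>\<^sub>F w in nhds z. (a w, b w) \<noteq> 0"
      by (rule sphere_holomorphic_onE[OF assms z])
    have "isCont a z" "isCont b z"
      using ab by (simp_all add: analytic_at_imp_isCont)
    then have "isCont (\<lambda>w. (a w, b w)) z" by (intro continuous_intros)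
    moreover have "isCont proj_point (a z, b z)"
      using continuous_on_proj_point ab(3) continuous_on_eq_continuous_at[of "- {0}" proj_point]
      by (auto simp: open_Compl)
    ultimately have "isCont (\<lambda>w. proj_point (a w, b w)) z"
      by (rule isCont_o2)
    then show ?thesis using isCont_cong[OF ab(4)] by simp
  qed
  then show ?thesis by (simp add: continuous_at_imp_continuous_on)
qed

lemma sphere_holomorphic_on_compose:
  assumes F: "sphere_holomorphic_on F A" and \<phi>: "\<phi> holomorphic_on B" "open B" "\<phi> ` B \<subseteq> A"
  shows "sphere_holomorphic_on (F \<circ> \<phi>) B"
  unfolding sphere_holomorphic_on_def
proof
  fix z assume z: "z \<in> B"
  then have "\<phi> z \<in> A" using \<phi>(3) by blast
  then obtain a b where ab: "a analytic_on {\<phi> z}" "b analytic_on {\<phi> z}" "(a (\<phi> z), b (\<phi> z)) \<noteq> 0"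
    "\<forall>\<^sub>F w in nhds (\<phi> z). F w = proj_point (a w, b w)"
    "\<forall>\<^sub>F w in nhds (\<phi> z). (a w, b w) \<noteq> 0"
    by (rule sphere_holomorphic_onE[OF F])
  have an: "\<phi> analytic_on {z}"
    using \<phi> z by (auto simp: analytic_at)
  then have "filterlim \<phi> (nhds (\<phi> z)) (nhds z)"
    using analytic_at_imp_isCont[OF an] by (simp add: isCont_def tendsto_at_iff_tendsto_nhds)
  then have "\<forall>\<^sub>F w in nhds z. F (\<phi> w) = proj_point (a (\<phi> w), b (\<phi> w))"
    using ab(4) by (auto simp: filterlim_iff)
  moreover have "(a \<circ> \<phi>) analytic_on {z}" "(b \<circ> \<phi>) analytic_on {z}"
    using an ab by (auto intro!: analytic_on_compose)
  ultimately show "\<exists>a b. a analytic_on {z} \<and> b analytic_on {z} \<and> (a z, b z) \<noteq> 0 \<and>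
      (\<forall>\<^sub>F w in nhds z. (F \<circ> \<phi>) w = proj_point (a w, b w))"
    using ab(3) by (intro exI[of _ "a \<circ> \<phi>"] exI[of _ "b \<circ> \<phi>"]) auto
qed

section \<open>Meromorphic functions versus holomorphic maps into the sphere\<close>

text \<open>Local coordinates are \<open>[g : 1]\<close> at a regular point and
  \<open>[1 : inverse g]\<close> at a pole, where \<open>inverse g\<close> is analytic.\<close>

lemma sphere_meromorphic_on_imp_sphere_holomorphic_on:
  assumes f: "sphere_meromorphic_on f A" and A: "open A"
  shows "sphere_holomorphic_on f A"
  unfolding sphere_holomorphic_on_def
proof
  obtain g where g: "g nicely_meromorphic_on A"
    and fg: "\<And>z. z \<in> A \<Longrightarrow> f z = (if is_pole g z then Infty else Fin (g z))"
    using f unfolding sphere_meromorphic_on_def by blast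
  \<comment> \<open>The default value 0 of \<open>g\<close> at a pole makes \<open>inverse g\<close>
    vanish there, so \<open>[1 : inverse g]\<close> is \<open>Infty\<close> as required.\<close>
  have g0: "g z = 0" if "is_pole g z" "z \<in> A" for z
  proof -
    have "\<not> g \<midarrow>z\<rightarrow> g z"
      using that by (metis at_neq_bot is_pole_def not_tendsto_and_filterlim_at_infinity)
    then show ?thesis using g that unfolding nicely_meromorphic_on_def by blast
  qed
  fix z assume z: "z \<in> A"
  have evA: "\<forall>\<^sub>F w in nhds z. w \<in> A" using A z by (rule eventually_nhds_in_open)
  show "\<exists>a b. a analytic_on {z} \<and> b analytic_on {z} \<and> (a z, b z) \<noteq> 0 \<and>
        (\<forall>\<^sub>F w in nhds z. f w = proj_point (a w, b w))"
  proof (cases "is_pole g z")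
    case False
    then have an: "g analytic_on {z}"
      using nicely_meromorphic_on_imp_analytic_at[OF g z] by simp
    then obtain S where S: "open S" "z \<in> S" "g holomorphic_on S"
      by (auto simp: analytic_at)
    then have "\<forall>\<^sub>F w in nhds z. g analytic_on {w}"
      by (auto simp: eventually_nhds analytic_at)
    then have "\<forall>\<^sub>F w in nhds z. f w = proj_point (g w, 1)"
      using evA by eventually_elim (auto simp: fg proj_point_def dest: analytic_at_imp_no_pole)
    with an show ?thesis
      by (intro exI[of _ g] exI[of _ "\<lambda>_. 1"]) (auto simp: zero_prod_def)
  next
    case True
    let ?h = "\<lambda>w. inverse (g w)"
    have h: "?h nicely_meromorphic_on A"
      by (rule nicely_meromorphic_on_inverse[OF g])
    have "(?h \<longlongrightarrow> 0) (at z)"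
      using is_pole_tendsto[OF True] by (simp add: o_def)
    then have "\<not> is_pole ?h z"
      by (metis at_neq_bot is_pole_def not_tendsto_and_filterlim_at_infinity)
    then have an: "?h analytic_on {z}"
      using nicely_meromorphic_on_imp_analytic_at[OF h z] by simp
    \<comment> \<open>At a zero of \<open>g\<close> that is no pole, \<open>[1 : inverse g]\<close>
      would wrongly be \<open>Infty\<close>; close to a pole there is no such zero.\<close>
    have "\<forall>\<^sub>F w in at z. g w \<noteq> 0" using True by (rule non_zero_neighbour_pole)
    then have "\<forall>\<^sub>F w in nhds z. g w \<noteq> 0 \<or> is_pole g w"
      using True by (auto simp: eventually_nhds_conv_at elim: eventually_mono)
    then have "\<forall>\<^sub>F w in nhds z. f w = proj_point (1, ?h w)"
      using evA
      by eventually_elim (auto simp: fg proj_point_def g0 divide_inverse)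
    with an show ?thesis
      by (intro exI[of _ "\<lambda>_. 1"] exI[of _ ?h]) (auto simp: zero_prod_def)
  qed
qed

text \<open>An analytic denominator that is not identically zero near a point has no zero in a
  punctured neighbourhood. So the set where \<open>F\<close> is locally \<open>Infty\<close> is open
  with open complement in \<open>A\<close>, and by connectedness it is \<open>A\<close> or empty. If
  it is empty, \<open>F\<close> is locally a quotient \<open>a / b\<close> with isolated
  poles.\<close>

lemma sphere_holomorphic_on_imp_meromorphic:
  assumes F: "sphere_holomorphic_on F A" and A: "open A" "connected A"
  shows "sphere_meromorphic_on F A \<or> (\<forall>z\<in>A. F z = Infty)"
proof -
  define I where "I = {z \<in> A. \<forall>\<^sub>F w in nhds z. F w = Infty}"
  have neI: "\<forall>\<^sub>F w in at z. F w \<noteq> Infty"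
    if ab: "a analytic_on {z}" "b analytic_on {z}"
      "\<forall>\<^sub>F w in nhds z. F w = proj_point (a w, b w)" and z: "z \<in> A - I" for z a b
  proof -
    have "\<not> (\<forall>\<^sub>F w in nhds z. b w = 0)"
    proof
      assume "\<forall>\<^sub>F w in nhds z. b w = 0"
      then have "\<forall>\<^sub>F w in nhds z. F w = Infty"
        using ab(3) by eventually_elim (simp add: proj_point_def)
      then show False using z by (simp add: I_def)
    qed
    then have "\<forall>\<^sub>F w in at z. b w \<noteq> 0"
    proof (cases "b z = 0")
      case True
      assume "\<not> (\<forall>\<^sub>F w in nhds z. b w = 0)"
      then have "\<exists>\<^sub>F w in at z. b w \<noteq> 0"
        using True by (simp add: eventually_nhds_conv_at frequently_def)
      then show ?thesis
        using ab(2) by (intro non_zero_neighbour isolated_singularity_at_analytic not_essential_analytic)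
    next
      case False
      then show ?thesis
        using tendsto_imp_eventually_ne[of b "b z" "at z" 0] analytic_at_imp_isCont[OF ab(2)]
        by (simp add: isCont_def)
    qed
    moreover have "\<forall>\<^sub>F w in at z. F w = proj_point (a w, b w)"
      using ab(3) by (simp add: eventually_nhds_conv_at)
    ultimately show ?thesis by eventually_elim (simp add: proj_point_def)
  qed
  have I: "F w = Infty" if "w \<in> I" for w
    using that by (auto simp: I_def dest: eventually_nhds_x_imp_x)
  have "open I"
  proof (subst open_subopen, safe)
    fix z assume "z \<in> I"
    then have "z \<in> A" and "\<forall>\<^sub>F w in nhds z. F w = Infty" by (auto simp: I_def)
    then obtain S where S: "open S" "z \<in> S" "\<And>w. w \<in> S \<Longrightarrow> F w = Infty"
      by (auto simp: eventually_nhds)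
    have "A \<inter> S \<subseteq> I"
      using S by (auto simp: I_def eventually_nhds)
    then show "\<exists>T. open T \<and> z \<in> T \<and> T \<subseteq> I"
      using A S \<open>z \<in> A\<close> by blast
  qed
  moreover have "open (A - I)"
  proof (subst open_subopen, safe)
    fix z assume z: "z \<in> A" "z \<notin> I"
    obtain a b where "a analytic_on {z}" "b analytic_on {z}" "(a z, b z) \<noteq> 0"
      "\<forall>\<^sub>F w in nhds z. F w = proj_point (a w, b w)" "\<forall>\<^sub>F w in nhds z. (a w, b w) \<noteq> 0"
      by (rule sphere_holomorphic_onE[OF F z(1)])
    then have "\<forall>\<^sub>F w in at z. F w \<noteq> Infty"
      using neI z by blast
    then have "\<forall>\<^sub>F w in at z. w \<notin> I" by eventually_elim (use I in blast)
    then have "\<forall>\<^sub>F w in nhds z. w \<notin> I" using z by (simp add: eventually_nhds_conv_at)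
    moreover have "\<forall>\<^sub>F w in nhds z. w \<in> A" using A z by (simp add: eventually_nhds_in_open)
    ultimately have "\<forall>\<^sub>F w in nhds z. w \<in> A - I" by eventually_elim auto
    then show "\<exists>T. open T \<and> z \<in> T \<and> T \<subseteq> A - I" by (auto simp: eventually_nhds)
  qed
  ultimately have "I = {} \<or> A - I = {}"
    using connectedD[OF A(2), of I "A - I"] by (auto simp: I_def)
  then show ?thesis
  proof
    assume "A - I = {}"
    then show ?thesis using I by blast
  next
    assume "I = {}"
    \<comment> \<open>The value 0 at \<open>Infty\<close> matches the convention of
      \<open>nicely_meromorphic_on\<close> at poles.\<close>
    define g where "g z = (case F z of Fin w \<Rightarrow> w | Infty \<Rightarrow> 0)" for z
    have "((is_pole g z \<and> g z = 0) \<or> g \<midarrow>z\<rightarrow> g z) \<and> g meromorphic_on {z} \<and>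
        F z = (if is_pole g z then Infty else Fin (g z))" if z: "z \<in> A" for z
    proof -
      obtain a b where ab: "a analytic_on {z}" "b analytic_on {z}" "(a z, b z) \<noteq> 0"
        "\<forall>\<^sub>F w in nhds z. F w = proj_point (a w, b w)" "\<forall>\<^sub>F w in nhds z. (a w, b w) \<noteq> 0"
        by (rule sphere_holomorphic_onE[OF F z])
      have ev: "\<forall>\<^sub>F w in nhds z. g w = a w / b w"
        using ab(4) by eventually_elim (simp add: g_def proj_point_def)
      then have ev': "\<forall>\<^sub>F w in at z. g w = a w / b w"
        by (simp add: eventually_nhds_conv_at)
      have Fz: "F z = proj_point (a z, b z)" "g z = a z / b z"
        using ab(4) ev by (auto dest: eventually_nhds_x_imp_x)
      show ?thesis
      proof (cases "b z = 0")
        case False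
        have "(\<lambda>w. a w / b w) analytic_on {z}"
          using ab False by (intro analytic_intros) auto
        then have "g analytic_on {z}"
          using analytic_at_cong[OF ev refl] by simp
        then have "g \<midarrow>z\<rightarrow> g z" "\<not> is_pole g z" "g meromorphic_on {z}"
          using analytic_at_imp_isCont analytic_at_imp_no_pole analytic_on_imp_meromorphic_on
          by (auto simp: isCont_def)
        moreover have "F z = Fin (g z)" using False Fz by (simp add: proj_point_def)
        ultimately show ?thesis by simp
      next
        case True
        have b: "\<forall>\<^sub>F w in at z. b w \<noteq> 0"
        proof -
          have "\<forall>\<^sub>F w in at z. F w \<noteq> Infty" using neI ab z \<open>I = {}\<close> by auto
          moreover have "\<forall>\<^sub>F w in at z. F w = proj_point (a w, b w)"
            using ab(4) by (simp add: eventually_nhds_conv_at)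
          ultimately show ?thesis by eventually_elim (auto simp: proj_point_def)
        qed
        have "isCont b z" using ab by (simp add: analytic_at_imp_isCont)
        then have "filterlim b (at 0) (at z)"
          using b True by (simp add: filterlim_at isCont_def)
        moreover have "a z \<noteq> 0" using ab(3) True by (auto simp: zero_prod_def)
        ultimately have "is_pole (\<lambda>w. a w / b w) z"
          using ab(1) by (intro is_pole_divide analytic_at_imp_isCont)
        then have "is_pole g z" using is_pole_cong[OF ev' refl] by simp
        moreover have "(\<lambda>w. a w / b w) meromorphic_on {z}"
          using ab by (intro meromorphic_intros analytic_on_imp_meromorphic_on)
        then have "g meromorphic_on {z}"
          using meromorphic_on_cong[of "{z}" g "\<lambda>w. a w / b w" "{z}"] ev' by simp
        ultimately show ?thesis using True Fz by (simp add: proj_point_def)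
      qed
    qed
    then have "g nicely_meromorphic_on A \<and> (\<forall>z\<in>A. F z = (if is_pole g z then Infty else Fin (g z)))"
      unfolding nicely_meromorphic_on_def using meromorphic_on_meromorphic_at[of g A] by blast
    then show ?thesis unfolding sphere_meromorphic_on_def by blast
  qed
qed

section \<open>Cross ratios and omitted functions\<close>

lemma proj_point_eqE:
  assumes "proj_point v = proj_point w" "v \<noteq> 0" "w \<noteq> 0"
  obtains k where "k \<noteq> 0" "w = (k * fst v, k * snd v)"
proof -
  obtain a b c d where vw: "v = (a, b)" "w = (c, d)" by fastforce
  have wedge: "a * d = b * c"
    using assms proj_point_eq_iff[of v w] by (simp add: vw wedge_def)
  show ?thesis
  proof (cases "a = 0")
    case True
    then have "b \<noteq> 0" "c = 0" "d \<noteq> 0" using wedge assms by (auto simp: vw zero_prod_def)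
    then show ?thesis using True that[of "d / b"] by (simp add: vw)
  next
    case False
    then have "c \<noteq> 0" using wedge assms by (auto simp: vw zero_prod_def)
    then show ?thesis using False wedge that[of "c / a"] by (simp add: vw field_simps)
  qed
qed

text \<open>Normalised to take the values 0, 1, \<open>\<infinity>\<close> at \<open>v = e1, e2, e3\<close>.\<close>
definition cross_ratio ::
  "complex \<times> complex \<Rightarrow> complex \<times> complex \<Rightarrow> complex \<times> complex \<Rightarrow> complex \<times> complex \<Rightarrow> complex" where
  "cross_ratio v e1 e2 e3 = - (wedge v e1 * wedge e2 e3) / (wedge v e3 * wedge e1 e2)"

text \<open>Each vector occurs once in the numerator and once in the denominator, so the scaling
  factors cancel.\<close>

lemma cross_ratio_cong:
  assumes "proj_point v = proj_point v'" "v \<noteq> 0" "v' \<noteq> 0"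
    and "proj_point e1 = proj_point e1'" "e1 \<noteq> 0" "e1' \<noteq> 0"
    and "proj_point e2 = proj_point e2'" "e2 \<noteq> 0" "e2' \<noteq> 0"
    and "proj_point e3 = proj_point e3'" "e3 \<noteq> 0" "e3' \<noteq> 0"
  shows "cross_ratio v e1 e2 e3 = cross_ratio v' e1' e2' e3'"
proof -
  obtain k where k: "k \<noteq> 0" "v' = (k * fst v, k * snd v)"
    by (rule proj_point_eqE[OF assms(1-3)])
  obtain k1 where k1: "k1 \<noteq> 0" "e1' = (k1 * fst e1, k1 * snd e1)"
    by (rule proj_point_eqE[OF assms(4-6)])
  obtain k2 where k2: "k2 \<noteq> 0" "e2' = (k2 * fst e2, k2 * snd e2)"
    by (rule proj_point_eqE[OF assms(7-9)])
  obtain k3 where k3: "k3 \<noteq> 0" "e3' = (k3 * fst e3, k3 * snd e3)"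
    by (rule proj_point_eqE[OF assms(10-12)])
  have wedges: "wedge v' e1' = k * k1 * wedge v e1" "wedge e2' e3' = k2 * k3 * wedge e2 e3"
    "wedge v' e3' = k * k3 * wedge v e3" "wedge e1' e2' = k1 * k2 * wedge e1 e2"
    by (simp_all add: k k1 k2 k3 wedge_def algebra_simps)
  define c where "c = k * k1 * k2 * k3"
  have "c \<noteq> 0" using k k1 k2 k3 by (simp add: c_def)
  moreover have "cross_ratio v' e1' e2' e3' =
      (c * - (wedge v e1 * wedge e2 e3)) / (c * (wedge v e3 * wedge e1 e2))"
    unfolding cross_ratio_def wedges by (simp add: c_def mult_ac)
  ultimately show ?thesis by (simp add: cross_ratio_def)
qed

text \<open>The value 0 would make \<open>v\<close> parallel to \<open>e1\<close>. By the three-term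
  Pluecker identity among the wedges, the value 1 would make \<open>v\<close> parallel to
  \<open>e2\<close>.\<close>

lemma cross_ratio_omits:
  assumes "wedge v e1 \<noteq> 0" "wedge v e2 \<noteq> 0" "wedge v e3 \<noteq> 0"
    and "wedge e1 e2 \<noteq> 0" "wedge e1 e3 \<noteq> 0" "wedge e2 e3 \<noteq> 0"
  shows "cross_ratio v e1 e2 e3 \<noteq> 0" "cross_ratio v e1 e2 e3 \<noteq> 1"
proof -
  show "cross_ratio v e1 e2 e3 \<noteq> 0" using assms by (simp add: cross_ratio_def)
  have "wedge v e1 * wedge e2 e3 + wedge v e3 * wedge e1 e2 = wedge v e2 * wedge e1 e3"
    by (simp add: wedge_def algebra_simps)
  then have "wedge v e3 * wedge e1 e2 \<noteq> - (wedge v e1 * wedge e2 e3)"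
    using assms by (metis add.right_inverse mult_eq_0_iff)
  then show "cross_ratio v e1 e2 e3 \<noteq> 1"
    unfolding cross_ratio_def by (metis divide_eq_1_iff)
qed

text \<open>
  The inverse of the cross ratio: \<open>[0 : 1]\<close>, \<open>[1 : 1]\<close>, \<open>[1 : 0]\<close> are sent to the points
  represented by \<open>e1\<close>, \<open>e2\<close>, \<open>e3\<close>.
\<close>
definition frame_point ::
  "complex \<times> complex \<Rightarrow> complex \<times> complex \<Rightarrow> complex \<times> complex \<Rightarrow> complex \<times> complex \<Rightarrow> complex \<times> complex" where
  "frame_point x e1 e2 e3 =
     (fst x * wedge e1 e2 * fst e3 + snd x * wedge e2 e3 * fst e1,
      fst x * wedge e1 e2 * snd e3 + snd x * wedge e2 e3 * snd e1)"

lemma wedge_frame_point: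
  "wedge v (frame_point x e1 e2 e3) =
     fst x * wedge e1 e2 * wedge v e3 + snd x * wedge e2 e3 * wedge v e1"
  by (simp add: wedge_def frame_point_def algebra_simps)

text \<open>The vector is a combination of \<open>e3\<close> and \<open>e1\<close>: its wedge with
  \<open>e1\<close> isolates \<open>fst x\<close>, its wedge with \<open>e3\<close> isolates
  \<open>snd x\<close>.\<close>

lemma frame_point_nonzero:
  assumes "x \<noteq> 0" "wedge e1 e2 \<noteq> 0" "wedge e1 e3 \<noteq> 0" "wedge e2 e3 \<noteq> 0"
  shows "frame_point x e1 e2 e3 \<noteq> 0"
proof
  assume 0: "frame_point x e1 e2 e3 = 0"
  have "wedge v 0 = 0" "wedge v v = 0" for v by (simp_all add: wedge_def)
  moreover have "wedge e3 e1 = - wedge e1 e3" by (simp add: wedge_def)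
  ultimately have "fst x = 0" "snd x = 0"
    using wedge_frame_point[of e1 x e1 e2 e3] wedge_frame_point[of e3 x e1 e2 e3] assms 0 by auto
  then show False using \<open>x \<noteq> 0\<close> by (simp add: prod_eq_iff)
qed

text \<open>Here \<open>x\<close> is any homogeneous representative of the cross ratio. The two
  terms of \<open>wedge_frame_point\<close> then cancel, which makes the vector parallel to
  \<open>v\<close>.\<close>

lemma proj_point_frame_point_cross_ratio:
  assumes v: "v \<noteq> 0" "wedge v e3 \<noteq> 0"
    and e: "wedge e1 e2 \<noteq> 0" "wedge e1 e3 \<noteq> 0" "wedge e2 e3 \<noteq> 0"
    and x: "x \<noteq> 0" "fst x = snd x * cross_ratio v e1 e2 e3"
  shows "proj_point (frame_point x e1 e2 e3) = proj_point v"
proof -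
  have "wedge v (frame_point x e1 e2 e3) = 0"
    using v e by (simp add: wedge_frame_point x(2) cross_ratio_def)
  then show ?thesis
    using proj_point_eq_iff[OF v(1) frame_point_nonzero[OF x(1) e]] by simp
qed

text \<open>The representatives \<open>v\<close>, \<open>e1\<close>, \<open>e2\<close>,
  \<open>e3\<close> are chosen pointwise. Locally \<open>cross_ratio_cong\<close> replaces them by
  analytic coordinates, and \<open>ne\<close> keeps the denominator away from 0.\<close>

lemma cross_ratio_holomorphic_on:
  assumes U: "open U"
    and f: "sphere_holomorphic_on f U"
    and \<psi>: "sphere_holomorphic_on \<psi>1 U" "sphere_holomorphic_on \<psi>2 U" "sphere_holomorphic_on \<psi>3 U"
    and ne: "\<And>z. z \<in> U \<Longrightarrow> \<psi>1 z \<noteq> \<psi>2 z" "\<And>z. z \<in> U \<Longrightarrow> f z \<noteq> \<psi>3 z"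
    and v: "\<And>z. proj_point (v z) = f z" "\<And>z. v z \<noteq> 0"
    and e: "\<And>z. proj_point (e1 z) = \<psi>1 z" "\<And>z. e1 z \<noteq> 0"
      "\<And>z. proj_point (e2 z) = \<psi>2 z" "\<And>z. e2 z \<noteq> 0"
      "\<And>z. proj_point (e3 z) = \<psi>3 z" "\<And>z. e3 z \<noteq> 0"
  shows "(\<lambda>z. cross_ratio (v z) (e1 z) (e2 z) (e3 z)) holomorphic_on U"
proof -
  have "(\<lambda>z. cross_ratio (v z) (e1 z) (e2 z) (e3 z)) analytic_on {z}" if z: "z \<in> U" for z
  proof -
    obtain a b where f': "a analytic_on {z}" "b analytic_on {z}" "(a z, b z) \<noteq> 0"
      "\<forall>\<^sub>F w in nhds z. f w = proj_point (a w, b w)" "\<forall>\<^sub>F w in nhds z. (a w, b w) \<noteq> 0"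
      by (rule sphere_holomorphic_onE[OF f z])
    obtain a1 b1 where 1: "a1 analytic_on {z}" "b1 analytic_on {z}" "(a1 z, b1 z) \<noteq> 0"
      "\<forall>\<^sub>F w in nhds z. \<psi>1 w = proj_point (a1 w, b1 w)" "\<forall>\<^sub>F w in nhds z. (a1 w, b1 w) \<noteq> 0"
      by (rule sphere_holomorphic_onE[OF \<psi>(1) z])
    obtain a2 b2 where 2: "a2 analytic_on {z}" "b2 analytic_on {z}" "(a2 z, b2 z) \<noteq> 0"
      "\<forall>\<^sub>F w in nhds z. \<psi>2 w = proj_point (a2 w, b2 w)" "\<forall>\<^sub>F w in nhds z. (a2 w, b2 w) \<noteq> 0"
      by (rule sphere_holomorphic_onE[OF \<psi>(2) z])
    obtain a3 b3 where 3: "a3 analytic_on {z}" "b3 analytic_on {z}" "(a3 z, b3 z) \<noteq> 0"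
      "\<forall>\<^sub>F w in nhds z. \<psi>3 w = proj_point (a3 w, b3 w)" "\<forall>\<^sub>F w in nhds z. (a3 w, b3 w) \<noteq> 0"
      by (rule sphere_holomorphic_onE[OF \<psi>(3) z])
    have eq: "\<forall>\<^sub>F w in nhds z. cross_ratio (v w) (e1 w) (e2 w) (e3 w) =
        cross_ratio (a w, b w) (a1 w, b1 w) (a2 w, b2 w) (a3 w, b3 w)"
      using f'(4,5) 1(4,5) 2(4,5) 3(4,5)
    proof eventually_elim
      case (elim w)
      then show ?case by (intro cross_ratio_cong) (simp_all only: v e not_False_eq_True)
    qed
    have "\<psi>1 z = proj_point (a1 z, b1 z)" "\<psi>2 z = proj_point (a2 z, b2 z)"
      "\<psi>3 z = proj_point (a3 z, b3 z)" "f z = proj_point (a z, b z)"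
      using f'(4) 1(4) 2(4) 3(4) by (auto dest: eventually_nhds_x_imp_x)
    then have "wedge (a1 z, b1 z) (a2 z, b2 z) \<noteq> 0" "wedge (a z, b z) (a3 z, b3 z) \<noteq> 0"
      using ne[OF z] proj_point_eq_iff[OF 1(3) 2(3)] proj_point_eq_iff[OF f'(3) 3(3)] by auto
    then have "(\<lambda>w. cross_ratio (a w, b w) (a1 w, b1 w) (a2 w, b2 w) (a3 w, b3 w)) analytic_on {z}"
      unfolding cross_ratio_def wedge_def fst_conv snd_conv
      using f' 1 2 3 by (intro analytic_intros) auto
    then show ?thesis using analytic_at_cong[OF eq refl] by simp
  qed
  then show ?thesis
    using analytic_on_analytic_at analytic_imp_holomorphic by blast
qed

section \<open>Uniform limits and Montel's theorem for omitted values\<close>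

lemma uniform_limit_Pair:
  assumes "uniform_limit K f f' F" "uniform_limit K g g' F"
  shows "uniform_limit K (\<lambda>n x. (f n x, g n x)) (\<lambda>x. (f' x, g' x)) F"
proof (rule uniform_limitI)
  fix e :: real assume "e > 0"
  then have "e / 2 > 0" by simp
  from uniform_limitD[OF assms(1) this] uniform_limitD[OF assms(2) this]
  show "\<forall>\<^sub>F n in F. \<forall>x\<in>K. dist (f n x, g n x) (f' x, g' x) < e"
  proof eventually_elim
    case (elim n)
    show ?case
    proof
      fix x assume "x \<in> K"
      have "dist (f n x, g n x) (f' x, g' x) \<le> dist (f n x) (f' x) + dist (g n x) (g' x)"
        unfolding dist_Pair_Pair by (rule sqrt_sum_squares_le_sum) auto
      then show "dist (f n x, g n x) (f' x, g' x) < e" using elim \<open>x \<in> K\<close> by fastforce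
    qed
  qed
qed

text \<open>Since \<open>b \<notin> U\<close>, the punctured limit at \<open>b\<close> controls
  \<open>g\<close> at every point of \<open>U\<close> close to \<open>b\<close>.\<close>

lemma uniform_limit_compose_tendsto:
  assumes g: "(g \<longlongrightarrow> L) (at b within U)" and b: "b \<notin> U"
    and \<phi>: "uniform_limit K \<phi> (\<lambda>_. b) F" "\<And>n z. z \<in> K \<Longrightarrow> \<phi> n z \<in> U"
  shows "uniform_limit K (\<lambda>n z. g (\<phi> n z)) (\<lambda>_. L) F"
proof (rule uniform_limitI)
  fix e :: real assume "e > 0"
  then have "\<forall>\<^sub>F z in at b within U. dist (g z) L < e" using g by (rule_tac tendstoD)
  then obtain d where d: "d > 0" "\<And>z. z \<in> U \<Longrightarrow> dist z b < d \<Longrightarrow> dist (g z) L < e"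
    using b unfolding eventually_at by metis
  show "\<forall>\<^sub>F n in F. \<forall>z\<in>K. dist (g (\<phi> n z)) L < e"
    using uniform_limitD[OF \<phi>(1) d(1)] by eventually_elim (use d \<phi>(2) in blast)
qed

text \<open>Functions omitting 0 and 1 and bounded by 1 at one point are uniformly bounded on
  compact sets, a consequence of Schottky's theorem. The classical Montel theorem then
  applies.\<close>

lemma Montel_omit_0_1_bounded:
  fixes h :: "nat \<Rightarrow> complex \<Rightarrow> complex"
  assumes S: "open S" "connected S" "w \<in> S"
    and h: "\<And>n. h n holomorphic_on S" "\<And>n z. z \<in> S \<Longrightarrow> h n z \<noteq> 0 \<and> h n z \<noteq> 1"
    and inf: "infinite {n. norm (h n w) \<le> 1}"
  obtains s v where "strict_mono s" "v holomorphic_on S"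
    "\<And>K. compact K \<Longrightarrow> K \<subseteq> S \<Longrightarrow> uniform_limit K (\<lambda>n. h (s n)) v sequentially"
proof -
  define t where "t = enumerate {n. norm (h n w) \<le> 1}"
  have t: "strict_mono t" "\<And>n. norm (h (t n) w) \<le> 1"
    using strict_mono_enumerate[OF inf] enumerate_in_set[OF inf] by (auto simp: t_def)
  let ?H = "range (\<lambda>n. h (t n))"
  have bdd: "\<exists>B. \<forall>k\<in>?H. \<forall>z\<in>K. norm (k z) \<le> B" if K: "compact K" "K \<subseteq> S" for K
  proof -
    obtain B where "\<And>k z. k \<in> ?H \<Longrightarrow> z \<in> K \<Longrightarrow> norm (k z) \<le> B"
      by (rule GPicard3[OF S subset_refl, of ?H K]) (use h t K in auto)
    then show ?thesis by blast
  qed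
  obtain v r where v: "v holomorphic_on S" and r: "strict_mono r"
    and lim: "\<And>K. compact K \<Longrightarrow> K \<subseteq> S \<Longrightarrow> uniform_limit K ((\<lambda>n. h (t n)) \<circ> r) v sequentially"
    by (rule Montel[OF S(1), of ?H "\<lambda>n. h (t n)"]) (use h bdd in auto)
  then show ?thesis
    using that[OF strict_mono_o[OF t(1) r] v] by (simp add: o_def)
qed

text \<open>
  \<open>u n\<close> gives homogeneous coordinates of \<open>h (s n)\<close>, so that the limit \<open>[x : y]\<close> may be infinite.
\<close>
lemma Montel_omit_0_1:
  fixes h :: "nat \<Rightarrow> complex \<Rightarrow> complex"
  assumes S: "open S" "connected S" "S \<noteq> {}"
    and h: "\<And>n. h n holomorphic_on S" "\<And>n z. z \<in> S \<Longrightarrow> h n z \<noteq> 0 \<and> h n z \<noteq> 1"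
  obtains s u x y where "strict_mono s"
    "\<And>n z. z \<in> S \<Longrightarrow> u n z \<noteq> 0 \<and> fst (u n z) = snd (u n z) * h (s n) z"
    "x holomorphic_on S" "y holomorphic_on S" "\<And>z. (x z, y z) \<noteq> 0"
    "\<And>K. compact K \<Longrightarrow> K \<subseteq> S \<Longrightarrow> uniform_limit K u (\<lambda>z. (x z, y z)) sequentially"
proof -
  obtain w where w: "w \<in> S" using S by blast
  \<comment> \<open>For each \<open>n\<close>, \<open>h n w\<close> or its reciprocal has norm at
    most 1, so one alternative occurs infinitely often.\<close>
  have "norm (inverse (h n w)) \<le> 1" if "\<not> norm (h n w) \<le> 1" for n
    using that by (simp add: norm_inverse inverse_le_1_iff)
  then have "{n. norm (h n w) \<le> 1} \<union> {n. norm (inverse (h n w)) \<le> 1} = UNIV"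
    by blast
  then have "infinite {n. norm (h n w) \<le> 1} \<or> infinite {n. norm (inverse (h n w)) \<le> 1}"
    by (metis finite_Un infinite_UNIV_nat)
  then show ?thesis
  proof
    assume inf: "infinite {n. norm (h n w) \<le> 1}"
    obtain s v where sv: "strict_mono s" "v holomorphic_on S"
      "\<And>K. compact K \<Longrightarrow> K \<subseteq> S \<Longrightarrow> uniform_limit K (\<lambda>n. h (s n)) v sequentially"
      using Montel_omit_0_1_bounded[OF S(1,2) w h inf] by blast
    show ?thesis
    proof (rule that[OF sv(1), of "\<lambda>n z. (h (s n) z, 1)" v "\<lambda>_. 1"])
      show "uniform_limit K (\<lambda>n z. (h (s n) z, 1)) (\<lambda>z. (v z, 1)) sequentially"
        if "compact K" "K \<subseteq> S" for K
        using sv(3)[OF that] by (rule uniform_limit_Pair) (rule uniform_limit_const)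
    qed (use sv in \<open>auto simp: zero_prod_def\<close>)
  next
    assume inf: "infinite {n. norm (inverse (h n w)) \<le> 1}"
    \<comment> \<open>Reciprocals again omit 0 and 1, so the bounded case applies to them.\<close>
    have h': "(\<lambda>z. inverse (h n z)) holomorphic_on S"
      "z \<in> S \<Longrightarrow> inverse (h n z) \<noteq> 0 \<and> inverse (h n z) \<noteq> 1" for n z
      using h by (auto intro!: holomorphic_intros)
    obtain s v where sv: "strict_mono s" "v holomorphic_on S"
      "\<And>K. compact K \<Longrightarrow> K \<subseteq> S \<Longrightarrow> uniform_limit K (\<lambda>n z. inverse (h (s n) z)) v sequentially"
      using Montel_omit_0_1_bounded[OF S(1,2) w h' inf] by blast
    show ?thesis
    proof (rule that[OF sv(1), of "\<lambda>n z. (1, inverse (h (s n) z))" "\<lambda>_. 1" v])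
      show "uniform_limit K (\<lambda>n z. (1, inverse (h (s n) z))) (\<lambda>z. (1, v z)) sequentially"
        if "compact K" "K \<subseteq> S" for K
        by (rule uniform_limit_Pair[OF uniform_limit_const sv(3)[OF that]])
    qed (use sv h in \<open>auto simp: zero_prod_def\<close>)
  qed
qed

text \<open>The cross ratios along \<open>\<phi> n\<close> have a subsequence with limit
  \<open>[x : y]\<close>, while the values of the \<open>\<psi>\<close> functions tend to the
  distinct points \<open>c1\<close>, \<open>c2\<close>, \<open>c3\<close>.
  \<open>frame_point\<close> combines both into a limit for \<open>f\<close>.\<close>

lemma normal_sequence_of_three_omitted_functions:
  assumes U: "open U" "b \<notin> U"
    and f: "sphere_holomorphic_on f U"
    and \<psi>: "sphere_holomorphic_on \<psi>1 U" "sphere_holomorphic_on \<psi>2 U" "sphere_holomorphic_on \<psi>3 U"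
    and \<psi>_ne: "\<And>z. z \<in> U \<Longrightarrow> \<psi>1 z \<noteq> \<psi>2 z \<and> \<psi>1 z \<noteq> \<psi>3 z \<and> \<psi>2 z \<noteq> \<psi>3 z"
    and f_ne: "\<And>z. z \<in> U \<Longrightarrow> f z \<noteq> \<psi>1 z \<and> f z \<noteq> \<psi>2 z \<and> f z \<noteq> \<psi>3 z"
    and lim: "(\<psi>1 \<longlongrightarrow> c1) (at b within U)" "(\<psi>2 \<longlongrightarrow> c2) (at b within U)" "(\<psi>3 \<longlongrightarrow> c3) (at b within U)"
    and c: "c1 \<noteq> c2" "c1 \<noteq> c3" "c2 \<noteq> c3"
    and S: "open S" "connected S" "S \<noteq> {}"
    and \<phi>: "\<And>n :: nat. \<phi> n holomorphic_on S" "\<And>n. \<phi> n ` S \<subseteq> U"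
      "\<And>K. compact K \<Longrightarrow> K \<subseteq> S \<Longrightarrow> uniform_limit K \<phi> (\<lambda>_. b) sequentially"
  obtains s G where "strict_mono s" "sphere_holomorphic_on G S"
    "\<And>K. compact K \<Longrightarrow> K \<subseteq> S \<Longrightarrow> uniform_limit K (\<lambda>n z. f (\<phi> (s n) z)) G sequentially"
proof -
  obtain \<sigma>1 where \<sigma>1: "isCont \<sigma>1 c1" "\<And>q. \<sigma>1 q \<noteq> 0" "\<And>q. proj_point (\<sigma>1 q) = q"
    using continuous_section by blast
  obtain \<sigma>2 where \<sigma>2: "isCont \<sigma>2 c2" "\<And>q. \<sigma>2 q \<noteq> 0" "\<And>q. proj_point (\<sigma>2 q) = q"
    using continuous_section by blast
  obtain \<sigma>3 where \<sigma>3: "isCont \<sigma>3 c3" "\<And>q. \<sigma>3 q \<noteq> 0" "\<And>q. proj_point (\<sigma>3 q) = q"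
    using continuous_section by blast
  have wedge_iff: "wedge v w = 0 \<longleftrightarrow> proj_point v = proj_point w" if "v \<noteq> 0" "w \<noteq> 0" for v w
    using proj_point_eq_iff[OF that] by simp
  \<comment> \<open>Any representative of \<open>f z\<close> will do, because the cross ratio
    depends only on the points; the sections over the \<open>\<psi>\<close> functions must be
    continuous at the limit values.\<close>
  define h where "h z = cross_ratio (hom_coords (f z)) (\<sigma>1 (\<psi>1 z)) (\<sigma>2 (\<psi>2 z)) (\<sigma>3 (\<psi>3 z))" for z
  have h: "h holomorphic_on U"
    unfolding h_def using U f \<psi> \<psi>_ne f_ne \<sigma>1 \<sigma>2 \<sigma>3 hom_coords_nonzero proj_point_hom_coords
    by (intro cross_ratio_holomorphic_on[of U f \<psi>1 \<psi>2 \<psi>3]) auto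
  have wedges: "wedge (\<sigma>1 (\<psi>1 z)) (\<sigma>2 (\<psi>2 z)) \<noteq> 0" "wedge (\<sigma>1 (\<psi>1 z)) (\<sigma>3 (\<psi>3 z)) \<noteq> 0"
      "wedge (\<sigma>2 (\<psi>2 z)) (\<sigma>3 (\<psi>3 z)) \<noteq> 0"
      "wedge (hom_coords (f z)) (\<sigma>1 (\<psi>1 z)) \<noteq> 0" "wedge (hom_coords (f z)) (\<sigma>2 (\<psi>2 z)) \<noteq> 0"
      "wedge (hom_coords (f z)) (\<sigma>3 (\<psi>3 z)) \<noteq> 0" if "z \<in> U" for z
    using \<psi>_ne[OF that] f_ne[OF that]
    by (simp_all add: wedge_iff \<sigma>1 \<sigma>2 \<sigma>3 hom_coords_nonzero proj_point_hom_coords)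
  have h01: "h z \<noteq> 0 \<and> h z \<noteq> 1" if "z \<in> U" for z
    unfolding h_def using wedges[OF that] by (intro conjI cross_ratio_omits)
  have \<phi>U: "\<phi> n z \<in> U" if "z \<in> S" for n z using \<phi>(2) that by blast
  have h\<phi>: "(\<lambda>z. h (\<phi> n z)) holomorphic_on S" for n
    using holomorphic_on_compose_gen[OF \<phi>(1) h \<phi>(2)] by (simp add: o_def)
  have h\<phi>01: "h (\<phi> n z) \<noteq> 0 \<and> h (\<phi> n z) \<noteq> 1" if "z \<in> S" for n z
    using h01 \<phi>U[OF that] by blast
  obtain s u x y where s: "strict_mono s"
    and u: "\<And>n z. z \<in> S \<Longrightarrow> u n z \<noteq> 0 \<and> fst (u n z) = snd (u n z) * h (\<phi> (s n) z)"
    and xy: "x holomorphic_on S" "y holomorphic_on S" "\<And>z. (x z, y z) \<noteq> 0"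
    and ulim: "\<And>K. compact K \<Longrightarrow> K \<subseteq> S \<Longrightarrow> uniform_limit K u (\<lambda>z. (x z, y z)) sequentially"
    using Montel_omit_0_1[OF S, of "\<lambda>n z. h (\<phi> n z)", OF h\<phi> h\<phi>01] by blast
  define \<Phi> where "\<Phi> = (\<lambda>(x, e1, e2, e3). frame_point x e1 e2 e3)"
  \<comment> \<open>On this open set \<open>\<Phi>\<close> represents a genuine point. It contains
    all limit values, which permits passing to the uniform limit.\<close>
  define T where "T = {t. \<Phi> t \<noteq> 0}"
  have "isCont \<Phi> t" for t
    unfolding \<Phi>_def frame_point_def wedge_def case_prod_beta by (intro continuous_intros)
  then have cont: "continuous_on UNIV \<Phi>" by (simp add: continuous_at_imp_continuous_on)
  have T: "open T"
    unfolding T_def using open_Collect_neq[OF cont continuous_on_const[of _ 0]] by simp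
  have contT: "continuous_on T (\<lambda>t. proj_point (\<Phi> t))"
    by (rule continuous_on_compose2[OF continuous_on_proj_point continuous_on_subset[OF cont]])
       (auto simp: T_def)
  define E where "E = (\<sigma>1 c1, \<sigma>2 c2, \<sigma>3 c3)"
  have E: "wedge (\<sigma>1 c1) (\<sigma>2 c2) \<noteq> 0" "wedge (\<sigma>1 c1) (\<sigma>3 c3) \<noteq> 0" "wedge (\<sigma>2 c2) (\<sigma>3 c3) \<noteq> 0"
    using c by (simp_all add: wedge_iff \<sigma>1 \<sigma>2 \<sigma>3)
  have \<Phi>xy: "\<Phi> ((x z, y z), E) \<noteq> 0" for z
    unfolding \<Phi>_def E_def using frame_point_nonzero[OF xy(3) E] by simp
  define e where "e z = (\<sigma>1 (\<psi>1 z), \<sigma>2 (\<psi>2 z), \<sigma>3 (\<psi>3 z))" for z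
  have e: "(e \<longlongrightarrow> E) (at b within U)"
    unfolding e_def E_def
    by (intro tendsto_Pair isCont_tendsto_compose[OF \<sigma>1(1)] isCont_tendsto_compose[OF \<sigma>2(1)]
        isCont_tendsto_compose[OF \<sigma>3(1)] lim)
  have feq: "proj_point (\<Phi> (u n z, e (\<phi> (s n) z))) = f (\<phi> (s n) z)" if "z \<in> S" for n z
  proof -
    let ?w = "\<phi> (s n) z"
    have "proj_point (\<Phi> (u n z, e ?w)) = proj_point (hom_coords (f ?w))"
      unfolding \<Phi>_def e_def prod.case
      by (rule proj_point_frame_point_cross_ratio)
         (use wedges[OF \<phi>U[OF that]] u[OF that] hom_coords_nonzero in \<open>auto simp flip: h_def\<close>)
    then show ?thesis by (simp add: proj_point_hom_coords)
  qed
  \<comment> \<open>This applies to \<open>[x : y]\<close> a fixed invertible Moebius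
    transformation, determined by the limit frame \<open>E\<close>.\<close>
  define G where "G z = proj_point (\<Phi> ((x z, y z), E))" for z
  have "sphere_holomorphic_on (\<lambda>z. proj_point (fst (\<Phi> ((x z, y z), E)), snd (\<Phi> ((x z, y z), E)))) S"
    using \<Phi>xy S(1) xy(1,2)
    by (intro sphere_holomorphic_on_proj_point)
       (auto simp: \<Phi>_def frame_point_def E_def zero_prod_def intro!: holomorphic_intros)
  then have "sphere_holomorphic_on G S" by (simp add: G_def[abs_def])
  moreover have "uniform_limit K (\<lambda>n z. f (\<phi> (s n) z)) G sequentially" if K: "compact K" "K \<subseteq> S" for K
  proof -
    have \<phi>s: "uniform_limit K (\<lambda>n. \<phi> (s n)) (\<lambda>_. b) sequentially"
      using filterlim_compose[OF \<phi>(3)[OF K] filterlim_subseq[OF s]] by simp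
    have "uniform_limit K (\<lambda>n z. e (\<phi> (s n) z)) (\<lambda>_. E) sequentially"
      by (rule uniform_limit_compose_tendsto[OF e U(2) \<phi>s]) (use \<phi>U K in blast)
    then have lim: "uniform_limit K (\<lambda>n z. (u n z, e (\<phi> (s n) z))) (\<lambda>z. ((x z, y z), E)) sequentially"
      by (rule uniform_limit_Pair[OF ulim[OF K]])
    have "continuous_on K x" "continuous_on K y"
      using xy(1,2) K(2) by (meson continuous_on_subset holomorphic_on_imp_continuous_on)+
    then have "continuous_on K (\<lambda>z. ((x z, y z), E))"
      by (intro continuous_intros)
    then have "compact ((\<lambda>z. ((x z, y z), E)) ` K)" using K(1) by (rule compact_continuous_image)
    moreover have "(\<lambda>z. ((x z, y z), E)) ` K \<subseteq> T" using \<Phi>xy by (auto simp: T_def)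
    ultimately have "uniform_limit K (\<lambda>n z. proj_point (\<Phi> (u n z, e (\<phi> (s n) z)))) G sequentially"
      unfolding G_def by (rule uniform_limit_compose_continuous_on[OF lim _ _ T contT])
    then show ?thesis
      by (rule uniform_limit_cong[THEN iffD1, rotated 2]) (use feq K in \<open>auto intro!: always_eventually\<close>)
  qed
  ultimately show ?thesis using that[OF s] by blast
qed

section \<open>Dilations and limits of self-maps\<close>

text \<open>\<open>F n\<close> at \<open>z\<close> is the dilated function at
  \<open>z / r n\<close>. For large \<open>n\<close> this point lies in a slightly larger compact
  set, where convergence is uniform, and \<open>G (z / r n)\<close> tends to \<open>G z\<close>
  uniformly.\<close>

lemma uniform_limit_rescale:
  fixes F :: "nat \<Rightarrow> complex \<Rightarrow> 'a :: metric_space"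
  assumes G: "continuous_on (ball 0 1) G"
    and r: "r \<longlonglongrightarrow> 1" "\<And>n. r n > (0 :: real)"
    and lim: "\<And>K. compact K \<Longrightarrow> K \<subseteq> ball 0 1 \<Longrightarrow>
      uniform_limit K (\<lambda>n z. F n (of_real (r n) * z)) G sequentially"
    and K: "compact K" "K \<subseteq> ball 0 1"
  shows "uniform_limit K F G sequentially"
proof -
  obtain d where d: "d > 0" "(\<Union>x\<in>K. cball x d) \<subseteq> ball 0 1"
    using compact_subset_open_imp_cball_epsilon_subset[OF K(1) open_ball K(2)] by blast
  define L where "L = (\<Union>x\<in>K. cball x d)"
  have L: "compact L" "L \<subseteq> ball 0 1"
    unfolding L_def using d compact_minkowski_sum_cball[OF K(1)] by auto
  define u where "u n z = z / of_real (r n)" for n and z :: complex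
  have u: "uniform_limit K u (\<lambda>z. z) sequentially"
  proof (rule uniform_limitI)
    fix e :: real assume e: "e > 0"
    have "(\<lambda>n. inverse (r n)) \<longlonglongrightarrow> inverse 1" using r by (intro tendsto_inverse) auto
    from tendstoD[OF this e] show "\<forall>\<^sub>F n in sequentially. \<forall>z\<in>K. dist (u n z) z < e"
    proof eventually_elim
      case (elim n)
      show ?case
      proof
        fix z assume "z \<in> K"
        then have z: "norm z \<le> 1" using K(2) by force
        have "u n z - z = of_real (inverse (r n) - 1) * z"
          by (simp add: u_def algebra_simps divide_inverse)
        then have "dist (u n z) z = \<bar>inverse (r n) - 1\<bar> * norm z"
          by (metis dist_norm norm_mult norm_of_real)
        also have "\<dots> \<le> \<bar>inverse (r n) - 1\<bar>" using z by (simp add: mult_left_le)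
        also have "\<dots> < e" using elim by (simp add: dist_norm)
        finally show "dist (u n z) z < e" .
      qed
    qed
  qed
  have Gu: "uniform_limit K (\<lambda>n z. G (u n z)) G sequentially"
    by (rule uniform_limit_compose_continuous_on[OF u _ _ open_ball G]) (use K in auto)
  show ?thesis
  proof (rule uniform_limitI)
    fix e :: real assume e: "e > 0"
    have "\<forall>\<^sub>F n in sequentially. \<forall>z\<in>L. dist (F n (of_real (r n) * z)) (G z) < e / 2"
      using e by (intro uniform_limitD[OF lim[OF L]]) auto
    moreover have "\<forall>\<^sub>F n in sequentially. \<forall>z\<in>K. dist (G (u n z)) (G z) < e / 2"
      using e by (intro uniform_limitD[OF Gu]) auto
    moreover have "\<forall>\<^sub>F n in sequentially. \<forall>z\<in>K. dist (u n z) z < d"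
      by (rule uniform_limitD[OF u d(1)])
    ultimately show "\<forall>\<^sub>F n in sequentially. \<forall>z\<in>K. dist (F n z) (G z) < e"
    proof eventually_elim
      case (elim n)
      show ?case
      proof
        fix z assume z: "z \<in> K"
        have "of_real (r n) * u n z = z" using r(2)[of n] by (simp add: u_def)
        moreover have "u n z \<in> L" using elim(3) z by (force simp: L_def dist_commute)
        ultimately have "dist (F n z) (G (u n z)) < e / 2" using elim(1) by metis
        then show "dist (F n z) (G z) < e"
          using elim(2) z dist_triangle_half_l[of "F n z" "G (u n z)" e "G z"]
          by (metis dist_commute dist_triangle_half_r)
      qed
    qed
  qed
qed

text \<open>All maps are bounded by 1, so Montel's theorem applies. By the maximum modulus
  principle, a limit that attains modulus 1 inside the disc is constant.\<close>

lemma Montel_self_maps: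
  fixes \<phi> :: "nat \<Rightarrow> complex \<Rightarrow> complex"
  assumes \<phi>: "\<And>n. \<phi> n holomorphic_on ball 0 1" "\<And>n. \<phi> n ` ball 0 1 \<subseteq> ball 0 1"
  obtains r \<phi>' where "strict_mono r" "\<phi>' holomorphic_on ball 0 1"
    "\<And>K. compact K \<Longrightarrow> K \<subseteq> ball 0 1 \<Longrightarrow> uniform_limit K (\<lambda>n. \<phi> (r n)) \<phi>' sequentially"
    "\<phi>' ` ball 0 1 \<subseteq> ball 0 1 \<or> (\<exists>b\<in>sphere 0 1. \<forall>z\<in>ball 0 1. \<phi>' z = b)"
proof -
  have norm\<phi>: "norm (\<phi> n z) \<le> 1" if "z \<in> ball 0 1" for n z
    using \<phi>(2)[of n] that by force
  obtain \<phi>' r where hol: "\<phi>' holomorphic_on ball 0 1" and r: "strict_mono r"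
    and pw: "\<And>z. z \<in> ball 0 1 \<Longrightarrow> (\<lambda>n. \<phi> (r n) z) \<longlonglongrightarrow> \<phi>' z"
    and lim: "\<And>K. compact K \<Longrightarrow> K \<subseteq> ball 0 1 \<Longrightarrow> uniform_limit K (\<phi> \<circ> r) \<phi>' sequentially"
    by (rule Montel[of "ball 0 1" "range \<phi>" \<phi>])
       (use \<phi>(1) norm\<phi> in \<open>auto intro!: exI[of _ 1] simp del: mem_ball\<close>)
  have norm\<phi>': "norm (\<phi>' z) \<le> 1" if "z \<in> ball 0 1" for z
    by (rule tendsto_upperbound[OF tendsto_norm[OF pw[OF that]]]) (use norm\<phi> that in auto)
  have "\<phi>' ` ball 0 1 \<subseteq> ball 0 1 \<or> (\<exists>b\<in>sphere 0 1. \<forall>z\<in>ball 0 1. \<phi>' z = b)"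
  proof (rule disjCI)
    assume "\<not> (\<exists>b\<in>sphere 0 1. \<forall>z\<in>ball 0 1. \<phi>' z = b)"
    show "\<phi>' ` ball 0 1 \<subseteq> ball 0 1"
    proof (rule ccontr)
      assume "\<not> \<phi>' ` ball 0 1 \<subseteq> ball 0 1"
      then obtain \<xi> where \<xi>: "\<xi> \<in> ball 0 1" "norm (\<phi>' \<xi>) = 1"
        using norm\<phi>' by force
      have "\<phi>' constant_on ball 0 1"
        by (rule maximum_modulus_principle[OF hol, of "ball 0 1" \<xi>]) (use \<xi> norm\<phi>' in auto)
      then obtain b where "\<And>z. z \<in> ball 0 1 \<Longrightarrow> \<phi>' z = b" by (auto simp: constant_on_def)
      with \<xi> \<open>\<not> (\<exists>b\<in>sphere 0 1. \<forall>z\<in>ball 0 1. \<phi>' z = b)\<close> show False by auto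
    qed
  qed
  then show ?thesis using that[OF r hol] lim by (simp add: o_def)
qed

section \<open>Sequences of self-maps of the disc\<close>

text \<open>Near \<open>b\<close> the function \<open>f\<close> omits three functions with distinct
  values. The maps need not send the whole disc near \<open>b\<close>, so the result on omitted
  functions is applied to dilated maps and the dilation is undone afterwards.\<close>

lemma boundary_sequence_normal:
  assumes f: "sphere_holomorphic_on f (ball 0 1)"
    and \<psi>: "sphere_holomorphic_on \<psi>1 (ball 0 1)" "sphere_holomorphic_on \<psi>2 (ball 0 1)"
      "sphere_holomorphic_on \<psi>3 (ball 0 1)"
    and b: "b \<in> sphere 0 1"
    and cont: "continuous (at b within cball 0 1) \<psi>1" "continuous (at b within cball 0 1) \<psi>2"
      "continuous (at b within cball 0 1) \<psi>3"
    and ne: "\<psi>1 b \<noteq> \<psi>2 b" "\<psi>1 b \<noteq> \<psi>3 b" "\<psi>2 b \<noteq> \<psi>3 b"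
    and share: "\<And>z. z \<in> ball 0 1 \<Longrightarrow> \<psi>1 z = f z \<longleftrightarrow> \<psi>2 z = f z"
    and avoid: "\<And>z. z \<in> ball 0 1 \<Longrightarrow> \<psi>3 z \<noteq> f z"
    and \<phi>: "\<And>n :: nat. \<phi> n holomorphic_on ball 0 1" "\<And>n. \<phi> n ` ball 0 1 \<subseteq> ball 0 1"
      "\<And>K. compact K \<Longrightarrow> K \<subseteq> ball 0 1 \<Longrightarrow> uniform_limit K \<phi> (\<lambda>_. b) sequentially"
  obtains s G where "strict_mono s" "sphere_holomorphic_on G (ball 0 1)"
    "\<And>K. compact K \<Longrightarrow> K \<subseteq> ball 0 1 \<Longrightarrow> uniform_limit K (\<lambda>n z. f (\<phi> (s n) z)) G sequentially"
proof -
  let ?D = "ball 0 1 :: complex set"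
  have lim: "(\<psi>1 \<longlongrightarrow> \<psi>1 b) (at b within A)" "(\<psi>2 \<longlongrightarrow> \<psi>2 b) (at b within A)"
    "(\<psi>3 \<longlongrightarrow> \<psi>3 b) (at b within A)" if "A \<subseteq> cball 0 1" for A
    using cont that by (auto simp: continuous_within intro: tendsto_within_subset)
  have ev_ne: "\<forall>\<^sub>F z in at b within ?D. g z \<noteq> k z"
    if "(g \<longlongrightarrow> g b) (at b within ?D)" "(k \<longlongrightarrow> k b) (at b within ?D)" "g b \<noteq> k b"
    for g k :: "complex \<Rightarrow> riemann_sphere"
  proof -
    have "((\<lambda>z. dist (g z) (k z)) \<longlongrightarrow> dist (g b) (k b)) (at b within ?D)"
      using that by (intro tendsto_dist)
    then have "\<forall>\<^sub>F z in at b within ?D. dist (g z) (k z) \<noteq> 0"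
      by (rule tendsto_imp_eventually_ne) (use that in simp)
    then show ?thesis by eventually_elim auto
  qed
  have "\<forall>\<^sub>F z in at b within ?D. \<psi>1 z \<noteq> \<psi>2 z \<and> \<psi>1 z \<noteq> \<psi>3 z \<and> \<psi>2 z \<noteq> \<psi>3 z"
    using ne by (intro eventually_conj ev_ne lim ball_subset_cball)
  then obtain d where d: "d > 0"
    "\<And>z. z \<in> ?D \<Longrightarrow> z \<noteq> b \<Longrightarrow> dist z b < d \<Longrightarrow> \<psi>1 z \<noteq> \<psi>2 z \<and> \<psi>1 z \<noteq> \<psi>3 z \<and> \<psi>2 z \<noteq> \<psi>3 z"
    unfolding eventually_at by blast
  define U where "U = ?D \<inter> ball b d"
  have U: "open U" "b \<notin> U" "U \<subseteq> ?D" "U \<subseteq> cball 0 1"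
    using b by (auto simp: U_def)
  have \<psi>_ne: "\<psi>1 z \<noteq> \<psi>2 z \<and> \<psi>1 z \<noteq> \<psi>3 z \<and> \<psi>2 z \<noteq> \<psi>3 z" if "z \<in> U" for z
  proof -
    have "z \<noteq> b" using that U(2) by blast
    then show ?thesis using d(2)[of z] that by (simp add: U_def dist_commute)
  qed
  \<comment> \<open>Sharing would turn a point with \<open>f z = \<psi>1 z\<close> or
    \<open>f z = \<psi>2 z\<close> into one with \<open>\<psi>1 z = \<psi>2 z\<close>, excluded in
    \<open>U\<close>.\<close>
  have f_ne: "f z \<noteq> \<psi>1 z \<and> f z \<noteq> \<psi>2 z \<and> f z \<noteq> \<psi>3 z" if "z \<in> U" for z
    using \<psi>_ne[OF that] share[of z] avoid[of z] that U(3) by (metis subsetD)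
  have hol_U: "sphere_holomorphic_on g U" if "sphere_holomorphic_on g ?D" for g
    using that U(3) unfolding sphere_holomorphic_on_def by blast

  \<comment> \<open>With \<open>k + 2\<close> the radius is positive already at
    \<open>k = 0\<close>, as undoing the dilation requires.\<close>
  define \<rho> where "\<rho> k = 1 - inverse (real (k + 2))" for k
  have \<rho>: "0 < \<rho> k" "\<rho> k < 1" for k by (auto simp: \<rho>_def field_simps)
  have \<rho>lim: "\<rho> \<longlonglongrightarrow> 1"
  proof -
    have "(\<lambda>k. 1 - inverse (real (k + 2))) \<longlonglongrightarrow> 1 - 0"
      using LIMSEQ_ignore_initial_segment[OF LIMSEQ_inverse_real_of_nat, of 1]
      by (intro tendsto_diff tendsto_const) (simp add: numeral_2_eq_2)
    then show ?thesis by (simp add: \<rho>_def[abs_def])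
  qed
  \<comment> \<open>The bound \<open>d\<close> brings the images into \<open>U\<close>; the other
    bound gives convergence to \<open>b\<close>.\<close>
  have "\<exists>N. \<forall>n\<ge>N. \<forall>z\<in>cball 0 (\<rho> k). dist (\<phi> n z) b < min d (inverse (real (Suc k)))" for k
  proof -
    have "uniform_limit (cball 0 (\<rho> k)) \<phi> (\<lambda>_. b) sequentially"
      using \<rho>[of k] by (intro \<phi>(3)) auto
    then have "\<forall>\<^sub>F n in sequentially. \<forall>z\<in>cball 0 (\<rho> k). dist (\<phi> n z) b < min d (inverse (real (Suc k)))"
      using d(1) by (intro uniform_limitD) auto
    then show ?thesis by (simp add: eventually_sequentially)
  qed
  then obtain N where N: "\<And>k n z. n \<ge> N k \<Longrightarrow> z \<in> cball 0 (\<rho> k) \<Longrightarrow>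
      dist (\<phi> n z) b < min d (inverse (real (Suc k)))"
    by metis
  \<comment> \<open>Summing \<open>Suc (N j)\<close> makes \<open>m\<close> strictly increasing and
    at least \<open>N\<close>, for whatever \<open>N\<close> was chosen.\<close>
  define m where "m k = (\<Sum>j\<le>k. Suc (N j))" for k
  have m: "strict_mono m" "N k \<le> m k" for k
  proof -
    show "strict_mono m" by (rule strict_monoI_Suc) (simp add: m_def)
    have "Suc (N k) \<le> m k" unfolding m_def by (rule member_le_sum) auto
    then show "N k \<le> m k" by simp
  qed
  \<comment> \<open>\<open>\<phi> (m k)\<close> is close to \<open>b\<close> only on the smaller disc of radius \<open>\<rho> k\<close>, hence the rescaling.\<close>
  define \<phi>' where "\<phi>' k z = \<phi> (m k) (of_real (\<rho> k) * z)" for k z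
  have scale: "of_real (\<rho> k) * z \<in> ?D" "of_real (\<rho> k) * z \<in> cball 0 (\<rho> k)" if "z \<in> ?D" for k z
  proof -
    have "norm (of_real (\<rho> k) * z) \<le> \<rho> k"
      using that \<rho>[of k] mult_left_le[of "norm z" "\<rho> k"] by (simp add: norm_mult)
    then show "of_real (\<rho> k) * z \<in> ?D" "of_real (\<rho> k) * z \<in> cball 0 (\<rho> k)"
      using \<rho>[of k] by auto
  qed
  have \<phi>'_near: "dist (\<phi>' k z) b < min d (inverse (real (Suc k)))" if "z \<in> ?D" for k z
    unfolding \<phi>'_def by (rule N[OF m(2) scale(2)[OF that]])
  have \<phi>'U: "\<phi>' k ` ?D \<subseteq> U" for k
  proof
    fix w assume "w \<in> \<phi>' k ` ?D"
    then obtain z where z: "z \<in> ?D" "w = \<phi>' k z" by blast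
    have "w \<in> ?D" using scale(1)[OF z(1), of k] \<phi>(2)[of "m k"] unfolding z(2) \<phi>'_def by blast
    then show "w \<in> U" using \<phi>'_near[OF z(1), of k] z by (simp add: U_def dist_commute)
  qed
  have \<phi>'hol: "\<phi>' k holomorphic_on ?D" for k
  proof -
    have "(\<lambda>z. of_real (\<rho> k) * z) ` ?D \<subseteq> ?D" using scale(1) by blast
    then have "\<phi> (m k) \<circ> (\<lambda>z. of_real (\<rho> k) * z) holomorphic_on ?D"
      by (intro holomorphic_on_compose_gen[OF _ \<phi>(1)] holomorphic_intros)
    then show ?thesis by (simp add: \<phi>'_def[abs_def] o_def)
  qed
  have \<phi>'lim: "uniform_limit K \<phi>' (\<lambda>_. b) sequentially" if "K \<subseteq> ?D" for K
  proof (rule uniform_limitI)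
    fix e :: real assume "e > 0"
    then have "\<forall>\<^sub>F k in sequentially. inverse (real (Suc k)) < e"
      using LIMSEQ_inverse_real_of_nat by (rule_tac order_tendstoD(2))
    then show "\<forall>\<^sub>F k in sequentially. \<forall>z\<in>K. dist (\<phi>' k z) b < e"
    proof eventually_elim
      case (elim k)
      then show ?case using \<phi>'_near[of _ k] that by fastforce
    qed
  qed
  have D: "open ?D" "connected ?D" "?D \<noteq> {}" by auto
  obtain s G where s: "strict_mono s" and G: "sphere_holomorphic_on G ?D"
    and lim': "\<And>K. compact K \<Longrightarrow> K \<subseteq> ?D \<Longrightarrow> uniform_limit K (\<lambda>n z. f (\<phi>' (s n) z)) G sequentially"
    using normal_sequence_of_three_omitted_functions[OF U(1,2) hol_U[OF f] hol_U[OF \<psi>(1)] hol_U[OF \<psi>(2)]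
        hol_U[OF \<psi>(3)] \<psi>_ne f_ne lim(1)[OF U(4)] lim(2)[OF U(4)] lim(3)[OF U(4)] ne D \<phi>'hol \<phi>'U \<phi>'lim]
    by blast
  \<comment> \<open>The radii \<open>\<rho> (s n)\<close> tend to 1, so convergence passes from the
    dilated maps to the original ones.\<close>
  have "uniform_limit K (\<lambda>n z. f (\<phi> ((m \<circ> s) n) z)) G sequentially" if "compact K" "K \<subseteq> ?D" for K
  proof (rule uniform_limit_rescale[OF sphere_holomorphic_on_imp_continuous_on[OF G] _ _ _ that])
    show "(\<lambda>n. \<rho> (s n)) \<longlonglongrightarrow> 1"
      using LIMSEQ_subseq_LIMSEQ[OF \<rho>lim s] by (simp add: o_def)
  qed (use lim' \<rho> in \<open>simp_all add: \<phi>'_def\<close>)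
  then show ?thesis using that[OF strict_mono_o[OF m(1) s] G] by blast
qed

theorem theorem1p2:
  fixes f \<psi>1 \<psi>2 \<psi>3 :: "complex \<Rightarrow> riemann_sphere"
  assumes "sphere_meromorphic_on f (ball 0 1)"
    and "\<And>\<psi>. \<psi> \<in> {\<psi>1, \<psi>2, \<psi>3} \<Longrightarrow> sphere_meromorphic_on \<psi> (ball 0 1)"
    and "\<And>\<psi> z. \<psi> \<in> {\<psi>1, \<psi>2, \<psi>3} \<Longrightarrow> z \<in> sphere 0 1 \<Longrightarrow>
           continuous (at z within cball 0 1) \<psi>"
    and "\<And>z. z \<in> sphere 0 1 \<Longrightarrow> \<psi>1 z \<noteq> \<psi>2 z \<and> \<psi>1 z \<noteq> \<psi>3 z \<and> \<psi>2 z \<noteq> \<psi>3 z"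
    and share: "{z \<in> ball 0 1. \<psi>1 z = f z} = {z \<in> ball 0 1. \<psi>2 z = f z}"
    and avoid: "\<And>z. z \<in> ball 0 1 \<Longrightarrow> \<psi>3 z \<noteq> f z"
  shows "normal_function f"
proof -
  let ?D = "ball 0 1 :: complex set"
  \<comment> \<open>Sphere-valued holomorphic maps form a class that also admits the constant limit
    \<open>Infty\<close>.\<close>
  have f: "sphere_holomorphic_on f ?D"
    using assms(1) by (rule sphere_meromorphic_on_imp_sphere_holomorphic_on) simp
  have \<psi>: "sphere_holomorphic_on \<psi>1 ?D" "sphere_holomorphic_on \<psi>2 ?D" "sphere_holomorphic_on \<psi>3 ?D"
    using assms(2) by (auto intro!: sphere_meromorphic_on_imp_sphere_holomorphic_on)
  have share': "\<psi>1 z = f z \<longleftrightarrow> \<psi>2 z = f z" if "z \<in> ?D" for z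
    using share that by blast
  have "\<exists>r g. strict_mono r \<and>
      (\<forall>K. compact K \<and> K \<subseteq> ?D \<longrightarrow> uniform_limit K (F \<circ> r) g sequentially) \<and>
      (sphere_meromorphic_on g ?D \<or> (\<forall>z\<in>?D. g z = Infty))"
    if F: "range F \<subseteq> {f \<circ> \<phi> | \<phi>. \<phi> \<in> disc_automorphisms}" for F :: "nat \<Rightarrow> complex \<Rightarrow> riemann_sphere"
  proof -
    have "\<forall>n. \<exists>\<phi>. F n = f \<circ> \<phi> \<and> \<phi> \<in> disc_automorphisms" using F by blast
    then obtain \<phi> where F\<phi>: "\<And>n. F n = f \<circ> \<phi> n" and "\<And>n. \<phi> n \<in> disc_automorphisms"
      by metis
    then have \<phi>: "\<phi> n holomorphic_on ?D" "\<phi> n ` ?D \<subseteq> ?D" for n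
      by (auto simp: disc_automorphisms_def bij_betw_def simp del: mem_ball)
    obtain r \<phi>' where r: "strict_mono r" and \<phi>': "\<phi>' holomorphic_on ?D"
      and lim: "\<And>K. compact K \<Longrightarrow> K \<subseteq> ?D \<Longrightarrow> uniform_limit K (\<lambda>n. \<phi> (r n)) \<phi>' sequentially"
      and dich: "\<phi>' ` ?D \<subseteq> ?D \<or> (\<exists>b\<in>sphere 0 1. \<forall>z\<in>?D. \<phi>' z = b)"
      using Montel_self_maps[of \<phi>, OF \<phi>] by blast
    have "\<exists>s G. strict_mono s \<and> sphere_holomorphic_on G ?D \<and>
        (\<forall>K. compact K \<and> K \<subseteq> ?D \<longrightarrow> uniform_limit K (\<lambda>n z. f (\<phi> (s n) z)) G sequentially)"
      using dich
    proof
      \<comment> \<open>Interior case: the limit maps compact sets to compact subsets of the disc,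
        and \<open>f\<close> is continuous there.\<close>
      assume D: "\<phi>' ` ?D \<subseteq> ?D"
      have "uniform_limit K (\<lambda>n z. f (\<phi> (r n) z)) (f \<circ> \<phi>') sequentially"
        if K: "compact K" "K \<subseteq> ?D" for K
      proof -
        have "continuous_on K \<phi>'"
          using holomorphic_on_imp_continuous_on[OF \<phi>'] K(2) by (rule continuous_on_subset)
        then have "compact (\<phi>' ` K)" "\<phi>' ` K \<subseteq> ?D"
          using K D by (auto intro: compact_continuous_image simp del: mem_ball)
        then show ?thesis
          using uniform_limit_compose_continuous_on[OF lim[OF K] _ _ open_ball
              sphere_holomorphic_on_imp_continuous_on[OF f]] by (simp add: o_def)
      qed
      then show ?thesis
        using r sphere_holomorphic_on_compose[OF f \<phi>' open_ball D] by blast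
    next
      \<comment> \<open>Boundary case: the automorphisms converge to one point \<open>b\<close> of
        the circle, and a further subsequence is extracted.\<close>
      assume "\<exists>b\<in>sphere 0 1. \<forall>z\<in>?D. \<phi>' z = b"
      then obtain b where b: "b \<in> sphere 0 1" "\<And>z. z \<in> ?D \<Longrightarrow> \<phi>' z = b" by blast
      have lim_b: "uniform_limit K (\<lambda>n. \<phi> (r n)) (\<lambda>_. b) sequentially"
        if K: "compact K" "K \<subseteq> ?D" for K
        by (rule uniform_limit_cong[THEN iffD1, OF _ _ lim[OF K]]) (use b(2) K(2) in auto)
      have cont: "continuous (at b within cball 0 1) \<psi>1" "continuous (at b within cball 0 1) \<psi>2"
        "continuous (at b within cball 0 1) \<psi>3"
        using assms(3) b(1) by auto
      have ne: "\<psi>1 b \<noteq> \<psi>2 b" "\<psi>1 b \<noteq> \<psi>3 b" "\<psi>2 b \<noteq> \<psi>3 b"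
        using assms(4)[OF b(1)] by auto
      obtain s G where "strict_mono s" "sphere_holomorphic_on G ?D"
        "\<And>K. compact K \<Longrightarrow> K \<subseteq> ?D \<Longrightarrow> uniform_limit K (\<lambda>n z. f (\<phi> (r (s n)) z)) G sequentially"
        using boundary_sequence_normal[of f \<psi>1 \<psi>2 \<psi>3 b "\<lambda>n. \<phi> (r n)",
            OF f \<psi> b(1) cont ne share' avoid \<phi> lim_b] by blast
      then show ?thesis
        using strict_mono_o[OF r] by (intro exI[of _ "r \<circ> s"] exI[of _ G]) auto
    qed
    then obtain s G where s: "strict_mono s" and G: "sphere_holomorphic_on G ?D"
      and "\<And>K. compact K \<Longrightarrow> K \<subseteq> ?D \<Longrightarrow> uniform_limit K (\<lambda>n z. f (\<phi> (s n) z)) G sequentially"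
      by blast
    moreover have "F \<circ> s = (\<lambda>n z. f (\<phi> (s n) z))"
      by (simp add: F\<phi> fun_eq_iff)
    \<comment> \<open>Connectedness of the disc turns the sphere-valued limit into one of the two
      kinds allowed in a normal family.\<close>
    moreover have "sphere_meromorphic_on G ?D \<or> (\<forall>z\<in>?D. G z = Infty)"
      by (rule sphere_holomorphic_on_imp_meromorphic[OF G]) auto
    ultimately show ?thesis by (intro exI[of _ s] exI[of _ G]) simp
  qed
  then have "normal_family_on {f \<circ> \<phi> | \<phi>. \<phi> \<in> disc_automorphisms} ?D"
    unfolding normal_family_on_def by blast
  then show ?thesis using assms(1) by (simp add: normal_function_def)
qed

end
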